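(* Let $p$ and $q$ be integers such that $p\le -2$, $q\ge4$ and $|q|>|p|+1$. For $s\in\{\alpha,\beta\}$ put $$B^{\pm}_s=\frac{\sqrt[3]{s^{q-3p}}}{(s^qF_p + F_{p+q})^3}\bigg(\sqrt[3]{s^{4q}F_p^4}\pm\sqrt[3]{F^4_{p+q}}\mp 2\sqrt[3]{s^qF_p F_{p+q}}\,\Big(\sqrt[3]{s^{2q}F^2_p}\pm\sqrt[3]{F^2_{p+q}}\Big)\bigg).$$ Let $$T_1=\arctan \bigg( \frac{\sqrt 3\,\sqrt[3]{F_{p + q}}}{2\sqrt[3]{\alpha^q F_p} + \sqrt[3]{F_{p + q}} } \bigg),\quad T_2=\arctan\bigg( \frac{\sqrt 3\sqrt[3]{F_p}}{2(-1)^q\sqrt[3]{\alpha^qF_{p+q}} + \sqrt[3]{F_{p}} } \bigg),$$ $$G_1=\log\bigg( \frac{(-1)^p F_q}{\big(\sqrt[3]{\alpha^pF_{p + q}}- \sqrt[3]{\alpha^{p+q} F_p} \big)^3 }\bigg),\quad G_2=\log\bigg( \frac{\alpha^{p+q} F_q}{\big(\sqrt[3]{\alpha^qF_{p + q}} -(-1)^q \sqrt[3]{F_p}\big)^3} \bigg).$$ Then $$\begin{aligned}\frac{1}{F_q\sqrt[3]{F_pF_{p+q}}}\sum_{k = 1}^\infty (-1)^{k-p}\Big(\frac{27F_p F_{p + q}}{F_q^2} \Big)^{k} \frac{F_{(2p + q)k}}{\binom{3k}{k}} &= \frac{4(-1)^{p-1}\sqrt[3]{F^2_{p+q}F^2_p}\,\big(F^2_{p+q}-(-1)^qF_p^2\big)}{(F_{p+q}+\alpha^qF_p)^2(F_{p+q}+\beta^qF_p)^2}\\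 &\quad - \frac{2\sqrt{15}}{15}\big(B^{+}_{\alpha} T_1 + B^{+}_{\beta} T_2 \big) +\frac{\sqrt5}{15} \big(B^{-}_{\alpha}G_1 - B^{-}_{\beta}G_2 \big),\end{aligned}$$ and $$\begin{aligned}\frac{1}{F_q\sqrt[3]{F_pF_{p+q}}}\sum_{k = 1}^\infty (-1)^{k-p}\Big(\frac{27F_p F_{p + q}}{F_q^2} \Big)^{k} \frac{L_{(2p + q)k}}{\binom{3k}{k}} &= \frac{4(-1)^{p-q-1}\sqrt[3]{F^2_{p+q}F^2_p}}{F_q}\cdot \frac{F^2_pL_q+(-1)^qF^2_{p+q}L_q+4F_pF_{p+q}}{(F_{p+q}+\alpha^qF_p)^2 (F_{p+q}+\beta^qF_p)^2}\\ &\quad - \frac{2}{\sqrt3}\big(B^{+}_{\alpha} T_1 - B^{+}_{\beta} T_2 \big) + \frac{1}{3}\big( B^{-}_{\alpha}G_1 + B^{-}_{\beta}G_2 \big).\end{aligned}$$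
   Context: $F_n$ and $L_n$ are the Fibonacci and Lucas numbers, defined by $F_0=0$, $F_1=1$, $L_0=2$, $L_1=1$, $X_n=X_{n-1}+X_{n-2}$, and extended to negative indices by $F_{-j}=(-1)^{j-1}F_j$, $L_{-j}=(-1)^jL_j$. $\alpha=(1+\sqrt5)/2$, $\beta=(1-\sqrt5)/2$. $\sqrt[3]{t}$ denotes the real cube root (negative for $t<0$). The abbreviations $T_1,T_2,G_1,G_2$ are introduced only to shorten the display; they stand for exactly the expressions written in the paper. *)

theory Defs
  imports "HOL-Analysis.Analysis"
begin

fun fibN :: "nat \<Rightarrow> real" where
  "fibN 0 = 0" | "fibN (Suc 0) = 1" | "fibN (Suc (Suc n)) = fibN (Suc n) + fibN n"

fun lucN :: "nat \<Rightarrow> real" where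
  "lucN 0 = 2" | "lucN (Suc 0) = 1" | "lucN (Suc (Suc n)) = lucN (Suc n) + lucN n"

definition F :: "int \<Rightarrow> real" where
  "F n = (if n \<ge> 0 then fibN (nat n) else (-1) ^ (nat (-n) - 1) * fibN (nat (-n)))"

definition L :: "int \<Rightarrow> real" where
  "L n = (if n \<ge> 0 then lucN (nat n) else (-1) ^ (nat (-n)) * lucN (nat (-n)))"

definition \<alpha> :: real where "\<alpha> = (1 + sqrt 5) / 2"
definition \<beta> :: real where "\<beta> = (1 - sqrt 5) / 2"

text \<open>Real cube root (odd root, negative for negative arguments).\<close>
abbreviation cbrt :: "real \<Rightarrow> real" where "cbrt x \<equiv> root 3 x"

definition Bplus :: "int \<Rightarrow> int \<Rightarrow> real \<Rightarrow> real" where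
  "Bplus p q s = cbrt (s powi (q - 3*p)) / (s powi q * F p + F (p+q)) ^ 3 *
     (cbrt (s powi (4*q) * F p ^ 4) + cbrt (F (p+q) ^ 4)
      - 2 * cbrt (s powi q * F p * F (p+q)) * (cbrt (s powi (2*q) * F p ^ 2) + cbrt (F (p+q) ^ 2)))"

definition Bminus :: "int \<Rightarrow> int \<Rightarrow> real \<Rightarrow> real" where
  "Bminus p q s = cbrt (s powi (q - 3*p)) / (s powi q * F p + F (p+q)) ^ 3 *
     (cbrt (s powi (4*q) * F p ^ 4) - cbrt (F (p+q) ^ 4)
      + 2 * cbrt (s powi q * F p * F (p+q)) * (cbrt (s powi (2*q) * F p ^ 2) - cbrt (F (p+q) ^ 2)))"

definition T1 :: "int \<Rightarrow> int \<Rightarrow> real" where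
  "T1 p q = arctan (sqrt 3 * cbrt (F (p+q)) / (2 * cbrt (\<alpha> powi q * F p) + cbrt (F (p+q))))"

definition T2 :: "int \<Rightarrow> int \<Rightarrow> real" where
  "T2 p q = arctan (sqrt 3 * cbrt (F p) / (2 * (-1) powi q * cbrt (\<alpha> powi q * F (p+q)) + cbrt (F p)))"

definition G1 :: "int \<Rightarrow> int \<Rightarrow> real" where
  "G1 p q = ln ((-1) powi p * F q / (cbrt (\<alpha> powi p * F (p+q)) - cbrt (\<alpha> powi (p+q) * F p)) ^ 3)"

definition G2 :: "int \<Rightarrow> int \<Rightarrow> real" where
  "G2 p q = ln (\<alpha> powi (p+q) * F q / (cbrt (\<alpha> powi q * F (p+q)) - (-1) powi q * cbrt (F p)) ^ 3)"

end

theory Submission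
  imports Defs
begin

text \<open>
  For \<open>s \<in> {\<alpha>, \<beta>}\<close> put \<open>u = s\<^sup>q F\<^sub>p\<close> and \<open>v = F\<^sub>p\<^sub>+\<^sub>q\<close>.  Since \<open>v - u\<close> is \<open>F\<^sub>q\<close> times the \<open>p\<close>-th power of
  the conjugate of \<open>s\<close>, Binet's formula turns both series into combinations of \<open>S(z) = \<Sum> z\<^sup>k / (3k choose k)\<close>
  at the two points \<open>z = - 27 u v / (v - u)\<^sup>2\<close>.
  The Beta integral gives \<open>S(z) = \<integral> z t\<^sup>2 / (1 - z t\<^sup>2 (1 - t))\<^sup>2 dt\<close> over \<open>[0,1]\<close>.  Writing
  \<open>z = - 27 y\<^sup>3 / (1 - y\<^sup>3)\<^sup>2\<close>, where \<open>y\<^sup>3\<close> is \<open>v / u\<close> for \<open>\<alpha>\<close> and \<open>u / v\<close> for \<open>\<beta>\<close>, is Cardano's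
  parametrisation of the cubic in the denominator: its real root becomes \<open>(1 + y + y\<^sup>2) / (3 y)\<close>, so the
  integral is elementary and yields one logarithm and one arctangent.
\<close>

section \<open>The series as an integral\<close>

lemma has_integral_power_mult_power:
  "((\<lambda>s::real. s ^ m * (1 - s) ^ n) has_integral (fact m * fact n / fact (m + n + 1))) {0..1}"
proof -
  have "((\<lambda>t. t powr (real (m + 1) - 1) * (1 - t) powr (real (n + 1) - 1)) has_integral
      Beta (real (m + 1)) (real (n + 1))) {0..1}"
    by (rule has_integral_Beta_real) auto
  moreover have "Beta (real (m + 1)) (real (n + 1)) = fact m * fact n / fact (m + n + 1)"
    using Gamma_fact[of m, where ?'a = real] Gamma_fact[of n, where ?'a = real]
      Gamma_fact[of "m + n + 1", where ?'a = real]
    by (simp add: Beta_def add_ac)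
  ultimately have "((\<lambda>t. t powr (real (m + 1) - 1) * (1 - t) powr (real (n + 1) - 1)) has_integral
      (fact m * fact n / fact (m + n + 1))) {0..1}"
    by simp
  then show ?thesis
    \<comment> \<open>At the endpoints \<open>powr\<close> and \<open>^\<close> may disagree, since
      \<open>0 powr 0 = 0\<close> while \<open>0 ^ 0 = 1\<close>; two points do not affect the
      integral.\<close>
    by (rule has_integral_spike_finite[rotated 2, where S = "{0,1}"]) (auto simp: powr_realpow)
qed

text \<open>With \<open>n = Suc k\<close> this is
  \<open>1 / (3n choose n) = n * B(2n + 1, n)\<close>: the factor \<open>n\<close> turns
  \<open>(n - 1)!\<close> into \<open>n!\<close>. The same factor later makes the sum under the
  integral a differentiated geometric series.\<close>

lemma inverse_binomial_integral:
  "((\<lambda>s::real. real (Suc k) * z ^ Suc k * (s ^ (2 * k + 2) * (1 - s) ^ k)) has_integral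
     (z ^ Suc k / real ((3 * Suc k) choose (Suc k)))) {0..1}"
proof -
  have "real ((3 * Suc k) choose (Suc k)) = fact (3 * k + 3) / (fact (Suc k) * fact (2 * k + 2))"
    by (subst binomial_fact) (auto simp: algebra_simps)
  moreover have "fact (Suc k) = real (Suc k) * fact k"
    by (rule fact_Suc)
  ultimately have "z ^ Suc k / real ((3 * Suc k) choose (Suc k)) =
      real (Suc k) * z ^ Suc k * (fact (2 * k + 2) * fact k / fact (2 * k + 2 + k + 1))"
    by (simp add: field_simps del: of_nat_Suc fact_Suc)
      (simp add: algebra_simps eval_nat_numeral)
  then show ?thesis
    using has_integral_mult_right[OF has_integral_power_mult_power, of "real (Suc k) * z ^ Suc k" "2 * k + 2" k]
    by simp
qed

lemma square_mult_one_minus_bounds: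
  fixes s :: real
  assumes "0 \<le> s" "s \<le> 1"
  shows "0 \<le> s\<^sup>2 * (1 - s)" "s\<^sup>2 * (1 - s) \<le> 4 / 27"
proof -
  show "0 \<le> s\<^sup>2 * (1 - s)"
    using assms by simp
  \<comment> \<open>The maximum lies at \<open>s = 2 / 3\<close>, hence the double root. Its value
    is the reciprocal of the radius of convergence \<open>27 / 4\<close>.\<close>
  have "4 / 27 - s\<^sup>2 * (1 - s) = (s - 2 / 3)\<^sup>2 * (s + 1 / 3)"
    by (simp add: field_simps power2_eq_square power3_eq_cube)
  also have "\<dots> \<ge> 0"
    using assms by simp
  finally show "s\<^sup>2 * (1 - s) \<le> 4 / 27"
    by simp
qed

text \<open>Under the integral sign stands the differentiated geometric series in
  \<open>z * s^2 * (1 - s)\<close>. This argument is at most \<open>r < 1\<close> in absolute value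
  on the whole interval, so the convergence is uniform and summation and integration may be
  exchanged.\<close>

lemma inverse_binomial_sums_integral:
  fixes z :: real
  assumes z: "\<bar>z\<bar> < 27 / 4"
    and I: "((\<lambda>s. z * s\<^sup>2 / (1 - z * s\<^sup>2 + z * s ^ 3)\<^sup>2) has_integral I) {0..1}"
  shows "(\<lambda>k. z ^ Suc k / real ((3 * Suc k) choose (Suc k))) sums I"
proof -
  define f where "f k s = real (Suc k) * z ^ Suc k * (s ^ (2 * k + 2) * (1 - s) ^ k)" for k and s :: real
  define g where "g s = z * s\<^sup>2 / (1 - z * s\<^sup>2 + z * s ^ 3)\<^sup>2" for s :: real
  define r where "r = \<bar>z\<bar> * (4 / 27)"
  have r: "0 \<le> r" "r < 1"
    using z by (auto simp: r_def)
  have f_eq: "f k s = z * s\<^sup>2 * (real (Suc k) * (z * (s\<^sup>2 * (1 - s))) ^ k)" for k s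
  proof -
    have "s ^ (2 * k) = (s\<^sup>2) ^ k"
      by (rule power_mult)
    then show ?thesis
      unfolding f_def power_mult_distrib power_add power_Suc by (simp only: ac_simps)
  qed
  have w_le: "\<bar>z * (s\<^sup>2 * (1 - s))\<bar> \<le> r" if "s \<in> {0..1}" for s
    using square_mult_one_minus_bounds[of s] that
    unfolding r_def abs_mult by (intro mult_left_mono) auto
  have f_sums: "(\<lambda>k. f k s) sums g s" if "s \<in> {0..1}" for s
  proof -
    have "norm (z * (s\<^sup>2 * (1 - s))) < 1"
      using w_le[OF that] r by simp
    note sums_mult[OF geometric_deriv_sums[OF this], of "z * s\<^sup>2"]
    moreover have "1 - z * (s\<^sup>2 * (1 - s)) = 1 - z * s\<^sup>2 + z * s ^ 3"
      by algebra
    then have "z * s\<^sup>2 * (1 / (1 - z * (s\<^sup>2 * (1 - s)))\<^sup>2) = g s"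
      by (simp only: g_def times_divide_eq_right mult_1_right)
    ultimately show ?thesis
      by (simp only: f_eq)
  qed
  have bound: "norm (f k s) \<le> \<bar>z\<bar> * (real (Suc k) * r ^ k)" if "s \<in> {0..1}" for k s
  proof -
    have "norm (f k s) = \<bar>z\<bar> * s\<^sup>2 * (real (Suc k) * \<bar>z * (s\<^sup>2 * (1 - s))\<bar> ^ k)"
      by (simp only: f_eq real_norm_def abs_mult power_abs power2_abs abs_of_nat)
    also have "\<dots> \<le> \<bar>z\<bar> * 1 * (real (Suc k) * r ^ k)"
      using that r w_le[OF that]
      by (intro mult_mono mult_left_mono power_mono) (auto simp: power_le_one)
    finally show ?thesis by simp
  qed
  have "summable (\<lambda>k. real (Suc k) * r ^ k)"
    using geometric_deriv_sums[of r] r sums_summable by fastforce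
  then have summable: "summable (\<lambda>k. \<bar>z\<bar> * (real (Suc k) * r ^ k))"
    by (rule summable_mult)
  have "uniform_limit {0..1} (\<lambda>n s. \<Sum>k<n. f k s) (\<lambda>s. \<Sum>k. f k s) sequentially"
    by (rule Weierstrass_m_test[OF _ summable]) (rule bound)
  also have "?this \<longleftrightarrow> uniform_limit {0..1} (\<lambda>n s. \<Sum>k<n. f k s) g sequentially"
    using f_sums by (intro uniform_limit_cong') (auto simp: sums_iff)
  finally have lim: "uniform_limit {0..1} (\<lambda>n s. \<Sum>k<n. f k s) g sequentially" .
  obtain J K where JK: "\<And>n. ((\<lambda>s. \<Sum>k<n. f k s) has_integral J n) {0..1}"
      "(g has_integral K) {0..1}" "J \<longlonglongrightarrow> K"
    by (rule uniform_limit_integral[OF lim]) (auto simp: f_def intro!: continuous_intros)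
  \<comment> \<open>The limit theorem yields its own integrals \<open>J n\<close> and
    \<open>K\<close>; uniqueness identifies them with the partial sums and with
    \<open>I\<close>.\<close>
  have "K = I"
    using JK(2) I unfolding g_def by (rule has_integral_unique)
  moreover have "J n = (\<Sum>k<n. z ^ Suc k / real ((3 * Suc k) choose (Suc k)))" for n
  proof (rule has_integral_unique[OF JK(1)])
    show "((\<lambda>s. \<Sum>k<n. f k s) has_integral (\<Sum>k<n. z ^ Suc k / real ((3 * Suc k) choose (Suc k)))) {0..1}"
      unfolding f_def by (intro has_integral_sum inverse_binomial_integral) auto
  qed
  then have "J = (\<lambda>n. \<Sum>k<n. z ^ Suc k / real ((3 * Suc k) choose (Suc k)))"
    by (rule ext)
  ultimately show ?thesis
    using JK(3) unfolding sums_def by (simp only:)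
qed

section \<open>Evaluation of the integral\<close>

text \<open>
  The constants \<open>A\<close>, \<open>B\<close>, \<open>a\<close>, \<open>d\<close> come from Hermite reduction of \<open>w\<^sup>2 / ((1 - w) q)\<^sup>2\<close>; comparing
  coefficients leaves the linear relations \<open>AB\<close>, \<open>1\<close>, \<open>2\<close>, \<open>3\<close> of the proof.
\<close>
lemma rational_antiderivative_identity:
  fixes k w :: real
  assumes "k > 1 / 4" "w \<noteq> 1" "1 + w + k * w\<^sup>2 \<noteq> 0"
  defines "K \<equiv> k - 1" and "\<Delta> \<equiv> (k + 2)\<^sup>2 * (4 * k - 1)"
  defines "A \<equiv> 2 * K\<^sup>2 / \<Delta>" and "B \<equiv> 6 * k * K / \<Delta>" and "a \<equiv> 9 * k / \<Delta>" and "d \<equiv> 2 * K / (k + 2) ^ 3"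
  defines "q \<equiv> 1 + w + k * w\<^sup>2"
  shows "((- A + 2 * B * w) * ((1 - w) * q) - (a - A * w + B * w\<^sup>2) * (2 * K * w - 3 * k * w\<^sup>2)) / ((1 - w) * q)\<^sup>2
    + d / (1 - w) + d / 2 * ((1 + 2 * k * w) / q) + (A - d - d / 2) / q = w\<^sup>2 / ((1 - w) * q)\<^sup>2"
proof -
  have \<Delta>: "\<Delta> \<noteq> 0" and k2: "k + 2 \<noteq> 0" "4 * k - 1 \<noteq> 0"
    using assms(1) by (auto simp: \<Delta>_def)
  have AB: "A + B = (k + 2) * d"
    using k2 unfolding A_def B_def d_def \<Delta>_def K_def
    by (simp add: divide_simps) algebra
  have 1: "3 * k * a + 2 * K * A = 1"
    using k2 unfolding A_def a_def \<Delta>_def K_def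
    by (simp add: divide_simps) algebra
  have 2: "K * B = 3 * k * A" and 3: "3 * B = 2 * K * a"
    by (simp_all add: A_def B_def a_def power2_eq_square)
  \<comment> \<open>\<open>2 * K * w - 3 * k * w^2\<close> is the derivative of the cubic
    \<open>(1 - w) * q = 1 + K * w^2 - k * w^3\<close>. What Hermite's step leaves has simple poles
    only, \<open>d / (1 - w) + (A - d + k * d * w) / q\<close>; the second fraction is split into a
    multiple of \<open>q' / q\<close> and a constant over \<open>q\<close>.\<close>
  have num: "(- A + 2 * B * w) * ((1 - w) * q) - (a - A * w + B * w\<^sup>2) * (2 * K * w - 3 * k * w\<^sup>2)
     + (d * q + (A - d + k * d * w) * (1 - w)) * ((1 - w) * q) = w\<^sup>2"
    using AB 1 2 3 unfolding q_def K_def by algebra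
  define R where "R = (1 - w) * q"
  have nz: "1 - w \<noteq> 0" "q \<noteq> 0"
    using assms(2,3) by (auto simp: q_def)
  have *: "d / (1 - w) + d / 2 * ((1 + 2 * k * w) / q) + (A - d - d / 2) / q
     = (d * q + (A - d + k * d * w) * (1 - w)) * R / R\<^sup>2"
    using nz unfolding R_def by (simp add: divide_simps) algebra
  show ?thesis
    using num * unfolding R_def[symmetric] 
    by (simp add: add.assoc flip: add_divide_distrib)
qed

lemma has_field_derivative_arctan_divide:
  fixes f g :: "real \<Rightarrow> real"
  assumes "(f has_field_derivative f') (at x within S)" "(g has_field_derivative g') (at x within S)" "g x \<noteq> 0"
  shows "((\<lambda>x. arctan (f x / g x)) has_field_derivative ((f' * g x - f x * g') / ((g x)\<^sup>2 + (f x)\<^sup>2)))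
     (at x within S)"
proof -
  have "(g x)\<^sup>2 + (f x)\<^sup>2 \<noteq> 0"
    using assms(3) by (simp add: sum_power2_eq_zero_iff)
  moreover have "inverse (1 + (f x / g x)\<^sup>2) = (g x)\<^sup>2 / ((g x)\<^sup>2 + (f x)\<^sup>2)"
    using assms(3) calculation by (simp add: field_simps)
  ultimately have "inverse (1 + (f x / g x)\<^sup>2) * ((f' * g x - f x * g') / (g x * g x))
      = (f' * g x - f x * g') / ((g x)\<^sup>2 + (f x)\<^sup>2)"
    using assms(3) by (simp add: divide_simps power2_eq_square)
  then show ?thesis
    using DERIV_chain2[OF DERIV_arctan DERIV_divide[OF assms]] by simp
qed

text \<open>
  The difference form comes out of the antiderivative; no further addition theorem is applied to it,
  since its tangent has a pole at \<open>y = - 1 / 2\<close>.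
\<close>
lemma arctan_diff_eq_triple_arctan:
  fixes y :: real
  assumes "-1 < y" "y < 1"
  shows "arctan ((1 + 4 * y + y\<^sup>2) / (sqrt 3 * (1 - y\<^sup>2))) - arctan ((1 - y) / (sqrt 3 * (1 + y)))
    = 3 * arctan (sqrt 3 * y / (2 + y))"
proof -
  define D where "D y = arctan ((1 + 4 * y + y\<^sup>2) / (sqrt 3 * (1 - y\<^sup>2))) - arctan ((1 - y) / (sqrt 3 * (1 + y)))
    - 3 * arctan (sqrt 3 * y / (2 + y))" for y :: real
  \<comment> \<open>The three arctangents have as derivatives \<open>1\<close>,
    \<open>- 1 / 2\<close> and \<open>1 / 2\<close> times \<open>sqrt 3 / (1 + x + x^2)\<close>, and
    \<open>1 + 1 / 2 - 3 / 2 = 0\<close>.\<close>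
  have "\<exists>c. \<forall>y\<in>{-1<..<1}. D y = c"
  proof (rule has_field_derivative_zero_constant)
    fix x :: real assume x: "x \<in> {-1<..<1}"
    have "(1 - x) * (1 + x) > 0" using x by simp
    then have nz1: "1 - x\<^sup>2 > 0" by (simp add: algebra_simps power2_eq_square)
    have "1 + x + x\<^sup>2 = (x + 1/2)\<^sup>2 + 3/4" by (simp add: field_simps power2_eq_square)
    then have P: "1 + x + x\<^sup>2 > 0" by (simp add: add_nonneg_pos)
    have "((\<lambda>y. arctan ((1 + 4 * y + y\<^sup>2) / (sqrt 3 * (1 - y\<^sup>2)))) has_field_derivative
        (((4 + 2 * x) * (sqrt 3 * (1 - x\<^sup>2)) - (1 + 4 * x + x\<^sup>2) * (sqrt 3 * (- 2 * x)))
        / ((sqrt 3 * (1 - x\<^sup>2))\<^sup>2 + (1 + 4 * x + x\<^sup>2)\<^sup>2))) (at x within {-1<..<1})"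
      using nz1 by (intro has_field_derivative_arctan_divide) (auto intro!: derivative_eq_intros)
    also have "((4 + 2 * x) * (sqrt 3 * (1 - x\<^sup>2)) - (1 + 4 * x + x\<^sup>2) * (sqrt 3 * (- 2 * x)))
        = sqrt 3 * (4 * (1 + x + x\<^sup>2))"
      by algebra
    also have "(sqrt 3 * (1 - x\<^sup>2))\<^sup>2 + (1 + 4 * x + x\<^sup>2)\<^sup>2 = 4 * (1 + x + x\<^sup>2)\<^sup>2"
      by (simp add: power_mult_distrib) algebra
    also have "sqrt 3 * (4 * (1 + x + x\<^sup>2)) / (4 * (1 + x + x\<^sup>2)\<^sup>2) = sqrt 3 / (1 + x + x\<^sup>2)"
      using P by (simp add: divide_simps) (simp add: power2_eq_square)
    finally have 1: "((\<lambda>y. arctan ((1 + 4 * y + y\<^sup>2) / (sqrt 3 * (1 - y\<^sup>2)))) has_field_derivative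
        (sqrt 3 / (1 + x + x\<^sup>2))) (at x within {-1<..<1})" .
    have quot: "u * 2 / (4 * v) = u / v / 2" for u v :: real
      by simp
    have "((\<lambda>y. arctan ((1 - y) / (sqrt 3 * (1 + y)))) has_field_derivative
        ((- 1 * (sqrt 3 * (1 + x)) - (1 - x) * sqrt 3)
        / ((sqrt 3 * (1 + x))\<^sup>2 + (1 - x)\<^sup>2))) (at x within {-1<..<1})"
      using x by (intro has_field_derivative_arctan_divide) (auto intro!: derivative_eq_intros)
    also have "- 1 * (sqrt 3 * (1 + x)) - (1 - x) * sqrt 3 = - sqrt 3 * 2"
      by algebra
    also have "(sqrt 3 * (1 + x))\<^sup>2 + (1 - x)\<^sup>2 = 4 * (1 + x + x\<^sup>2)"
      by (simp add: power_mult_distrib) algebra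
    also note quot
    finally have 2: "((\<lambda>y. arctan ((1 - y) / (sqrt 3 * (1 + y)))) has_field_derivative
        (- sqrt 3 / (1 + x + x\<^sup>2) / 2)) (at x within {-1<..<1})" .
    have "((\<lambda>y. arctan (sqrt 3 * y / (2 + y))) has_field_derivative
        ((sqrt 3 * (2 + x) - sqrt 3 * x * 1)
        / ((2 + x)\<^sup>2 + (sqrt 3 * x)\<^sup>2))) (at x within {-1<..<1})"
      using x by (intro has_field_derivative_arctan_divide) (auto intro!: derivative_eq_intros)
    also have "sqrt 3 * (2 + x) - sqrt 3 * x * 1 = sqrt 3 * 2"
      by algebra
    also have "(2 + x)\<^sup>2 + (sqrt 3 * x)\<^sup>2 = 4 * (1 + x + x\<^sup>2)"
      by (simp add: power_mult_distrib) algebra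
    also note quot
    finally have 3: "((\<lambda>y. arctan (sqrt 3 * y / (2 + y))) has_field_derivative
        (sqrt 3 / (1 + x + x\<^sup>2) / 2)) (at x within {-1<..<1})" .
    have cancel: "u / v - - u / v / 2 - 3 * (u / v / 2) = 0" for u v :: real
      by (simp add: field_simps)
    show "(D has_field_derivative 0) (at x within {-1<..<1})"
      unfolding D_def by (rule DERIV_cong[OF DERIV_diff[OF DERIV_diff[OF 1 2] DERIV_cmult[OF 3, of 3]] cancel])
  qed auto
  \<comment> \<open>At \<open>y = 0\<close> the first two arctangents coincide and the third
    vanishes.\<close>
  then have "D y = D 0" using assms by force
  then show ?thesis by (simp add: D_def)
qed

text \<open>For \<open>k > 1 / 4\<close> the quadratic factor has negative discriminant. The only
  real pole is then \<open>w = 1\<close>, and one primitive serves on the whole half-line to its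
  left.\<close>

lemma rational_antiderivative:
  fixes k w :: real
  assumes k: "k > 1 / 4" and w: "w < 1"
  defines "K \<equiv> k - 1" and "\<Delta> \<equiv> (k + 2)\<^sup>2 * (4 * k - 1)" and "\<rho> \<equiv> sqrt (4 * k - 1)"
  defines "A \<equiv> 2 * K\<^sup>2 / \<Delta>" and "B \<equiv> 6 * k * K / \<Delta>" and "a \<equiv> 9 * k / \<Delta>" and "d \<equiv> 2 * K / (k + 2) ^ 3"
  shows "((\<lambda>w. (a - A * w + B * w\<^sup>2) / ((1 - w) * (1 + w + k * w\<^sup>2))
            - d * ln (1 - w) + d / 2 * ln (1 + w + k * w\<^sup>2)
            + (A - d - d / 2) * (2 / \<rho>) * arctan ((1 + 2 * k * w) / \<rho>))
     has_field_derivative (w\<^sup>2 / ((1 - w) * (1 + w + k * w\<^sup>2))\<^sup>2)) (at w)"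
proof -
  define q where "q = 1 + w + k * w\<^sup>2"
  have \<rho>: "\<rho> > 0" "\<rho>\<^sup>2 = 4 * k - 1"
    using k by (auto simp: \<rho>_def)
  have "4 * k * q = (1 + 2 * k * w)\<^sup>2 + \<rho>\<^sup>2"
    unfolding \<rho>(2) q_def by algebra
  also have "\<dots> > 0" using \<rho>(1) by (simp add: add_nonneg_pos)
  finally have q: "q > 0" using k by (simp add: zero_less_mult_iff)
  have 1: "((\<lambda>w. (a - A * w + B * w\<^sup>2) / ((1 - w) * (1 + w + k * w\<^sup>2))) has_field_derivative
      ((- A + 2 * B * w) * ((1 - w) * q) - (a - A * w + B * w\<^sup>2) * (2 * K * w - 3 * k * w\<^sup>2)) / ((1 - w) * q)\<^sup>2) (at w)"
    using w q unfolding power2_eq_square[of "(1 - w) * q"]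
    apply (auto intro!: derivative_eq_intros simp: q_def)
    apply (simp add: K_def power2_eq_square algebra_simps)
    done
  have 2: "((\<lambda>w. ln (1 - w)) has_field_derivative (- (1 / (1 - w)))) (at w)"
    using w by (auto intro!: derivative_eq_intros)
  have 3: "((\<lambda>w. ln (1 + w + k * w\<^sup>2)) has_field_derivative ((1 + 2 * k * w) / q)) (at w)"
    using q by (auto intro!: derivative_eq_intros simp: q_def)
  have "((\<lambda>w. arctan ((1 + 2 * k * w) / \<rho>)) has_field_derivative
        ((2 * k * \<rho> - (1 + 2 * k * w) * 0) / (\<rho>\<^sup>2 + (1 + 2 * k * w)\<^sup>2))) (at w)"
    using \<rho> by (intro has_field_derivative_arctan_divide) (auto intro!: derivative_eq_intros)
  also have "\<rho>\<^sup>2 + (1 + 2 * k * w)\<^sup>2 = 4 * k * q"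
    unfolding \<rho>(2) q_def by algebra
  also have "(2 * k * \<rho> - (1 + 2 * k * w) * 0) / (4 * k * q) = \<rho> / (2 * q)"
    using k by (simp add: field_simps)
  finally have 4: "((\<lambda>w. arctan ((1 + 2 * k * w) / \<rho>)) has_field_derivative (\<rho> / (2 * q))) (at w)" .
  have 5: "((- A + 2 * B * w) * ((1 - w) * q) - (a - A * w + B * w\<^sup>2) * (2 * K * w - 3 * k * w\<^sup>2)) / ((1 - w) * q)\<^sup>2
     - d * (- (1 / (1 - w))) + d / 2 * ((1 + 2 * k * w) / q) + (A - d - d / 2) * (2 / \<rho>) * (\<rho> / (2 * q))
     = w\<^sup>2 / ((1 - w) * q)\<^sup>2"
  proof -
    have e: "d * (- (1 / (1 - w))) = - (d / (1 - w))"
      "(A - d - d / 2) * (2 / \<rho>) * (\<rho> / (2 * q)) = (A - d - d / 2) / q"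
      using \<rho>(1) q by (simp_all add: field_simps)
    show ?thesis
      using rational_antiderivative_identity[of k w, folded K_def \<Delta>_def q_def, folded A_def B_def a_def d_def] k w q
      unfolding e by simp
  qed
  show ?thesis
    using DERIV_add[OF DERIV_add[OF DERIV_diff[OF 1 DERIV_cmult[OF 2, of d]] DERIV_cmult[OF 3, of "d / 2"]]
      DERIV_cmult[OF 4, of "(A - d - d / 2) * (2 / \<rho>)"], unfolded 5]
    by (simp add: q_def)
qed

text \<open>The letters \<open>t\<close>, \<open>r\<close>, \<open>e\<close>, \<open>E\<close> stand
  for \<open>1 - y\<close>, \<open>1 + y\<close>, \<open>1 + y + y^2\<close>,
  \<open>1 - y + y^2\<close>, so that \<open>t * e = 1 - y^3\<close> and
  \<open>r * E = 1 + y^3\<close>. As independent letters they leave only monomial denominators to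
  clear.\<close>

lemma partial_fraction_values:
  fixes t r e E y :: real
  assumes "t \<noteq> 0" "r \<noteq> 0" "e \<noteq> 0" "E \<noteq> 0"
  shows rational_part_value:
    "- (e / t\<^sup>2) * (2 * y * e * t\<^sup>2 / (3 * E\<^sup>2 * r\<^sup>2) * (3 * y / e)\<^sup>2 - 2 * y\<^sup>2 * t\<^sup>2 / (3 * E\<^sup>2 * r\<^sup>2) * (3 * y / e))
      = - 4 * y ^ 3 / (r * E)\<^sup>2"
    and log_part_value:
    "- (e / t\<^sup>2) * (3 / 2 * (2 * y * t ^ 4 / (9 * E ^ 3))) = - 1 / 3 * (y * (t * e) * (t * r ^ 3) / (r * E) ^ 3)"
    and arctan_part_value:
    "- (e / t\<^sup>2) * ((2 * y\<^sup>2 * t\<^sup>2 / (3 * E\<^sup>2 * r\<^sup>2) - 3 / 2 * (2 * y * t ^ 4 / (9 * E ^ 3))) * (t / r) * 3)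
      = y * (t * e) * (t\<^sup>2 * r\<^sup>2 - 2 * y * E) / (r * E) ^ 3"
  using assms by (simp_all add: field_simps eval_nat_numeral)

text \<open>The closed form of \<open>S(z)\<close> at \<open>z = - 27 y^3 / (1 - y^3)^2\<close>.
  Homogenised by \<open>y = b / a\<close>, its two quartics become the brackets in
  \<open>Bplus\<close> and \<open>Bminus\<close>.\<close>

definition cubic_series_value :: "real \<Rightarrow> real" where
  "cubic_series_value y =
     - 4 * y ^ 3 / (1 + y ^ 3)\<^sup>2
     + 2 / sqrt 3 * (y * (1 - y ^ 3) * (1 - 2 * y - 2 * y ^ 3 + y ^ 4) / (1 + y ^ 3) ^ 3)
         * arctan (sqrt 3 * y / (2 + y))
     - 1 / 3 * (y * (1 - y ^ 3) * (1 + 2 * y - 2 * y ^ 3 - y ^ 4) / (1 + y ^ 3) ^ 3)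
         * ln ((1 - y ^ 3) / (1 - y) ^ 3)"

text \<open>The hypothesis \<open>conv\<close> is the condition
  \<open>\<bar>z\<bar> < 27 / 4\<close> expressed by \<open>y\<close>. The value is the increment of
  the primitive in \<open>w\<close> from \<open>0\<close> to \<open>x\<close>, times
  \<open>- k\<close>.\<close>

lemma cubic_series_sums:
  fixes y :: real
  assumes y: "y \<noteq> 0" "-1 < y" "y < 1" and conv: "4 * \<bar>y ^ 3\<bar> < (1 - y ^ 3)\<^sup>2"
  shows "(\<lambda>k. (- 27 * y ^ 3 / (1 - y ^ 3)\<^sup>2) ^ Suc k / real ((3 * Suc k) choose (Suc k)))
    sums cubic_series_value y"
proof -
  define z where "z = - 27 * y ^ 3 / (1 - y ^ 3)\<^sup>2"
  define e where "e = 1 + y + y\<^sup>2"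
  define E where "E = 1 - y + y\<^sup>2"
  \<comment> \<open>Substituting \<open>w = x s\<close> turns the cubic \<open>1 - z s\<^sup>2 + z s\<^sup>3\<close> into \<open>(1 - w) (1 + w + k w\<^sup>2)\<close>.\<close>
  define k where "k = e / (1 - y)\<^sup>2"
  define x where "x = 3 * y / e"
  define \<rho> where "\<rho> = sqrt (4 * k - 1)"
  define \<Delta> where "\<Delta> = (k + 2)\<^sup>2 * (4 * k - 1)"
  define A where "A = 2 * (k - 1)\<^sup>2 / \<Delta>"
  define B where "B = 6 * k * (k - 1) / \<Delta>"
  define a where "a = 9 * k / \<Delta>"
  define d where "d = 2 * (k - 1) / (k + 2) ^ 3"
  define \<Phi> where "\<Phi> w = (a - A * w + B * w\<^sup>2) / ((1 - w) * (1 + w + k * w\<^sup>2))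
            - d * ln (1 - w) + d / 2 * ln (1 + w + k * w\<^sup>2)
            + (A - d - d / 2) * (2 / \<rho>) * arctan ((1 + 2 * k * w) / \<rho>)" for w
  have "e = (y + 1 / 2)\<^sup>2 + 3 / 4" "E = (y - 1 / 2)\<^sup>2 + 3 / 4"
    by (simp_all add: e_def E_def field_simps power2_eq_square)
  then have e: "e > 0" and E: "E > 0"
    by (simp_all add: add_nonneg_pos)
  have y3: "1 - y ^ 3 = (1 - y) * e" "1 + y ^ 3 = (1 + y) * E"
    by (simp_all add: e_def E_def power2_eq_square power3_eq_cube algebra_simps)
  have pos: "1 - y > 0" "1 + y > 0" using y by auto
  \<comment> \<open>Here the parametrisation pays off: \<open>4 * k - 1\<close> is three times a
    square, so \<open>\<rho>\<close> is rational in \<open>y\<close> up to the factor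
    \<open>sqrt 3\<close>.\<close>
  have k1: "k - 1 = 3 * y / (1 - y)\<^sup>2" and k2: "k + 2 = 3 * E / (1 - y)\<^sup>2"
    and k4: "4 * k - 1 = 3 * ((1 + y) / (1 - y))\<^sup>2"
  proof -
    have "k - 1 = (e - (1 - y)\<^sup>2) / (1 - y)\<^sup>2" "k + 2 = (e + 2 * (1 - y)\<^sup>2) / (1 - y)\<^sup>2"
      "4 * k - 1 = (4 * e - (1 - y)\<^sup>2) / (1 - y)\<^sup>2"
      using pos by (simp_all add: k_def diff_divide_distrib add_divide_distrib)
    moreover have "e - (1 - y)\<^sup>2 = 3 * y" "e + 2 * (1 - y)\<^sup>2 = 3 * E" "4 * e - (1 - y)\<^sup>2 = 3 * (1 + y)\<^sup>2"
      by (simp_all add: e_def E_def power2_eq_square algebra_simps)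
    ultimately show "k - 1 = 3 * y / (1 - y)\<^sup>2" "k + 2 = 3 * E / (1 - y)\<^sup>2"
      "4 * k - 1 = 3 * ((1 + y) / (1 - y))\<^sup>2"
      by (simp_all add: power_divide)
  qed
  have \<rho>: "\<rho> = sqrt 3 * ((1 + y) / (1 - y))"
    unfolding \<rho>_def k4 using pos by (simp add: real_sqrt_mult)
  have kgt: "k > 1 / 4"
  proof -
    have "3 * ((1 + y) / (1 - y))\<^sup>2 > 0" using pos by simp
    then show ?thesis unfolding k4[symmetric] by simp
  qed
  have x1: "1 - x = (1 - y)\<^sup>2 / e"
    using e unfolding x_def by (simp add: field_simps) (simp add: e_def power2_eq_square algebra_simps)
  moreover have "(1 - y)\<^sup>2 / e > 0"
    using e pos by simp
  ultimately have x_lt: "x < 1"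
    by linarith
  have z1: "z = - (k * x ^ 3)" and z2: "(k - 1) * x\<^sup>2 = - z"
  proof -
    have "- 27 * y ^ 3 / (t * e)\<^sup>2 = - (e / t\<^sup>2 * (3 * y / e) ^ 3)"
      "3 * y / t\<^sup>2 * (3 * y / e)\<^sup>2 = - (- 27 * y ^ 3 / (t * e)\<^sup>2)" for t
      using e by (simp_all add: field_simps eval_nat_numeral)
    then show "z = - (k * x ^ 3)" "(k - 1) * x\<^sup>2 = - z"
      unfolding z_def y3 k1 unfolding k_def x_def by blast+
  qed
  have \<Phi>: "(\<Phi> has_field_derivative (w\<^sup>2 / ((1 - w) * (1 + w + k * w\<^sup>2))\<^sup>2)) (at w)" if "w < 1" for w
    unfolding \<Phi>_def using rational_antiderivative[OF kgt that]
    by (simp only: A_def B_def a_def d_def \<Delta>_def \<rho>_def)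
  have integrand: "- k * (x * ((x * s)\<^sup>2 / ((1 - x * s) * (1 + x * s + k * (x * s)\<^sup>2))\<^sup>2))
      = z * s\<^sup>2 / (1 - z * s\<^sup>2 + z * s ^ 3)\<^sup>2" for s
  proof -
    have "(1 - x * s) * (1 + x * s + k * (x * s)\<^sup>2) = 1 + ((k - 1) * x\<^sup>2) * s\<^sup>2 + (- (k * x ^ 3)) * s ^ 3"
      by algebra
    also have "\<dots> = 1 - z * s\<^sup>2 + z * s ^ 3"
      unfolding z1[symmetric] z2 by simp
    finally show ?thesis
      by (simp add: z1 power2_eq_square power3_eq_cube)
  qed
  have "((\<lambda>s. z * s\<^sup>2 / (1 - z * s\<^sup>2 + z * s ^ 3)\<^sup>2) has_integral
      ((\<lambda>s. - k * \<Phi> (x * s)) 1 - (\<lambda>s. - k * \<Phi> (x * s)) 0)) {0..1}"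
  proof (rule fundamental_theorem_of_calculus)
    fix s :: real assume s: "s \<in> {0..1}"
    \<comment> \<open>The path \<open>w = x * s\<close> must not meet the pole \<open>w = 1\<close>:
      for \<open>x \<le> 0\<close> it stays nonpositive, otherwise it ends at
      \<open>x < 1\<close>.\<close>
    have "x * s < 1"
    proof (cases "x \<le> 0")
      case True
      then show ?thesis using s mult_nonpos_nonneg[of x s] by simp
    next
      case False
      then have "x * s \<le> x * 1" using s by (intro mult_left_mono) auto
      then show ?thesis using x_lt by simp
    qed
    from DERIV_cmult[OF DERIV_chain2[OF \<Phi>[OF this] DERIV_cmult_Id], of "- k"]
    have "((\<lambda>s. - k * \<Phi> (x * s)) has_field_derivative (z * s\<^sup>2 / (1 - z * s\<^sup>2 + z * s ^ 3)\<^sup>2)) (at s within {0..1})"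
      unfolding integrand[symmetric] by (simp add: mult_ac)
    then show "((\<lambda>s. - k * \<Phi> (x * s)) has_vector_derivative (z * s\<^sup>2 / (1 - z * s\<^sup>2 + z * s ^ 3)\<^sup>2)) (at s within {0..1})"
      by (simp add: has_real_derivative_iff_has_vector_derivative)
  qed simp
  then have int: "((\<lambda>s. z * s\<^sup>2 / (1 - z * s\<^sup>2 + z * s ^ 3)\<^sup>2) has_integral (- k * (\<Phi> x - \<Phi> 0))) {0..1}"
    by (simp add: algebra_simps)
  have "\<bar>z\<bar> < 27 / 4"
    using conv pos e unfolding z_def by (simp add: abs_mult field_simps y3)
  from inverse_binomial_sums_integral[OF this int]
  have sums: "(\<lambda>k. z ^ Suc k / real ((3 * Suc k) choose (Suc k))) sums (- k * (\<Phi> x - \<Phi> 0))" .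
  have kpos: "k > 0" using kgt by simp
  \<comment> \<open>The cubic \<open>1 - z s^2 + z s^3\<close> equals \<open>1\<close> at
    \<open>s = 1\<close> as well as at \<open>s = 0\<close>. Hence its two factors at
    \<open>w = x\<close> are reciprocal, both logarithms become multiples of \<open>ln k\<close>,
    and the constant \<open>a\<close> cancels in \<open>\<Phi> x - \<Phi> 0\<close>.\<close>
  have x1k: "1 - x = 1 / k"
    unfolding x1 k_def by simp
  have qk: "1 + x + k * x\<^sup>2 = k"
  proof -
    have "1 / k * (1 + x + k * x\<^sup>2) = 1 + (k - 1) * x\<^sup>2 + - (k * x ^ 3)"
      unfolding x1k[symmetric] by algebra
    also have "\<dots> = 1" unfolding z2 z1[symmetric] by simp
    finally show ?thesis using kpos by (simp add: field_simps)
  qed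
  have ln_k: "k = (1 - y ^ 3) / (1 - y) ^ 3"
    using pos unfolding y3 k_def by (simp add: power2_eq_square power3_eq_cube)
  have "(1 + 2 * k * x) / \<rho> = (1 + 4 * y + y\<^sup>2) / (sqrt 3 * (1 - y\<^sup>2))"
  proof -
    have "1 + 2 * k * x = (1 + 4 * y + y\<^sup>2) / (1 - y)\<^sup>2"
      unfolding k_def x_def using e pos by (simp add: field_simps) (simp add: power2_eq_square algebra_simps)
    moreover have "1 - y\<^sup>2 = (1 - y) * (1 + y)" by (simp add: power2_eq_square algebra_simps)
    ultimately show ?thesis
      unfolding \<rho> using pos by (simp add: power2_eq_square)
  qed
  moreover have "1 / \<rho> = (1 - y) / (sqrt 3 * (1 + y))"
    unfolding \<rho> by simp
  ultimately have atn: "arctan ((1 + 2 * k * x) / \<rho>) - arctan (1 / \<rho>) = 3 * arctan (sqrt 3 * y / (2 + y))"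
    using arctan_diff_eq_triple_arctan y by simp
  have A: "A = 2 * y\<^sup>2 * (1 - y)\<^sup>2 / (3 * E\<^sup>2 * (1 + y)\<^sup>2)"
    and B: "B = 2 * y * e * (1 - y)\<^sup>2 / (3 * E\<^sup>2 * (1 + y)\<^sup>2)"
    and d: "d = 2 * y * (1 - y) ^ 4 / (9 * E ^ 3)"
  proof -
    have 1: "2 * (3 * y / t\<^sup>2)\<^sup>2 / ((3 * E / t\<^sup>2)\<^sup>2 * (3 * (r / t)\<^sup>2)) = 2 * y\<^sup>2 * t\<^sup>2 / (3 * E\<^sup>2 * r\<^sup>2)"
      and 2: "6 * (e / t\<^sup>2) * (3 * y / t\<^sup>2) / ((3 * E / t\<^sup>2)\<^sup>2 * (3 * (r / t)\<^sup>2)) = 2 * y * e * t\<^sup>2 / (3 * E\<^sup>2 * r\<^sup>2)"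
      and 3: "2 * (3 * y / t\<^sup>2) / (3 * E / t\<^sup>2) ^ 3 = 2 * y * t ^ 4 / (9 * E ^ 3)"
      if "t > 0" "r > 0" for t r :: real
      using that E by (simp_all add: divide_simps)
    show "A = 2 * y\<^sup>2 * (1 - y)\<^sup>2 / (3 * E\<^sup>2 * (1 + y)\<^sup>2)"
      "B = 2 * y * e * (1 - y)\<^sup>2 / (3 * E\<^sup>2 * (1 + y)\<^sup>2)"
      "d = 2 * y * (1 - y) ^ 4 / (9 * E ^ 3)"
      unfolding A_def B_def d_def \<Delta>_def k1 k2 k4 unfolding k_def
      by (rule 1 2 3; fact pos)+
  qed
  define \<theta> where "\<theta> = arctan (sqrt 3 * y / (2 + y))"
  have \<Phi>x: "\<Phi> x = (a - A * x + B * x\<^sup>2) / 1 - d * (- ln k) + d / 2 * ln k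
      + (A - d - d / 2) * (2 / \<rho>) * arctan ((1 + 2 * k * x) / \<rho>)"
    unfolding \<Phi>_def qk x1k using kpos by (simp add: ln_div)
  have \<Phi>0: "\<Phi> 0 = a + (A - d - d / 2) * (2 / \<rho>) * arctan (1 / \<rho>)"
    unfolding \<Phi>_def by simp
  have "\<Phi> x - \<Phi> 0 = B * x\<^sup>2 - A * x + 3 / 2 * d * ln k
      + (A - 3 / 2 * d) * (2 / \<rho>) * (arctan ((1 + 2 * k * x) / \<rho>) - arctan (1 / \<rho>))"
  proof -
    have "(a - A * x + B * x\<^sup>2) / 1 - d * (- l) + d / 2 * l + (A - d - d / 2) * R * t
        - (a + (A - d - d / 2) * R * t') = B * x\<^sup>2 - A * x + 3 / 2 * d * l + (A - 3 / 2 * d) * R * (t - t')"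
      for l R t t' :: real
      by (simp add: field_simps)
    then show ?thesis unfolding \<Phi>x \<Phi>0 .
  qed
  then have diff: "\<Phi> x - \<Phi> 0 = B * x\<^sup>2 - A * x + 3 / 2 * d * ln k + (A - 3 / 2 * d) * (2 / \<rho>) * (3 * \<theta>)"
    unfolding atn \<theta>_def .
  have c1: "- k * (B * x\<^sup>2 - A * x) = - 4 * y ^ 3 / (1 + y ^ 3)\<^sup>2"
    unfolding A B k_def x_def y3 by (rule rational_part_value) (use pos e E in auto)
  have c2: "- k * (3 / 2 * d) = - 1 / 3 * (y * (1 - y ^ 3) * (1 + 2 * y - 2 * y ^ 3 - y ^ 4) / (1 + y ^ 3) ^ 3)"
  proof -
    have "1 + 2 * y - 2 * y ^ 3 - y ^ 4 = (1 - y) * (1 + y) ^ 3" by algebra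
    then show ?thesis
      unfolding d k_def y3 by (simp only:) (rule log_part_value, use pos e E in auto)
  qed
  have c3: "- k * ((A - 3 / 2 * d) * (2 / \<rho>) * 3) = 2 / sqrt 3 * (y * (1 - y ^ 3) * (1 - 2 * y - 2 * y ^ 3 + y ^ 4) / (1 + y ^ 3) ^ 3)"
  proof -
    have "1 - 2 * y - 2 * y ^ 3 + y ^ 4 = (1 - y)\<^sup>2 * (1 + y)\<^sup>2 - 2 * y * E"
      unfolding E_def by algebra
    then have "- k * ((A - 3 / 2 * d) * ((1 - y) / (1 + y)) * 3) = y * (1 - y ^ 3) * (1 - 2 * y - 2 * y ^ 3 + y ^ 4) / (1 + y ^ 3) ^ 3"
      unfolding A d k_def y3 by (simp only:) (rule arctan_part_value, use pos e E in auto)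
    note c3' = this
    have "2 / \<rho> = 2 / sqrt 3 * ((1 - y) / (1 + y))"
      unfolding \<rho> by simp
    then have "- k * ((A - 3 / 2 * d) * (2 / \<rho>) * 3) = 2 / sqrt 3 * (- k * ((A - 3 / 2 * d) * ((1 - y) / (1 + y)) * 3))"
      by (simp only: mult_minus_left mult_minus_right ac_simps)
    then show ?thesis unfolding c3' .
  qed
  have "- k * (\<Phi> x - \<Phi> 0) = - k * (B * x\<^sup>2 - A * x) + - k * ((A - 3 / 2 * d) * (2 / \<rho>) * 3) * \<theta>
     + - k * (3 / 2 * d) * ln k"
  proof -
    have "- k * (X + M * l + N * R * (3 * t)) = - k * X + - k * (N * R * 3) * t + - k * M * l" for X M N R l t
      by (simp add: algebra_simps)
    then show ?thesis unfolding diff .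
  qed
  also have "\<dots> = cubic_series_value y"
    unfolding c1 c2 c3 unfolding ln_k cubic_series_value_def \<theta>_def by simp
  finally have val: "- k * (\<Phi> x - \<Phi> 0) = cubic_series_value y" .
  show ?thesis
    using sums unfolding val unfolding z_def .
qed

section \<open>Fibonacci and Lucas numbers\<close>

lemma golden_conj:
  "\<alpha> * \<beta> = -1" "\<alpha> - \<beta> = sqrt 5" "\<alpha>\<^sup>2 = \<alpha> + 1" "\<beta>\<^sup>2 = \<beta> + 1" "\<alpha> > 3 / 2" "\<beta> \<noteq> 0" "\<alpha> \<noteq> 0"
proof -
  have s: "sqrt 5 * sqrt 5 = 5" "sqrt 5 > 2"
    by (auto simp: real_less_rsqrt)
  show 1: "\<alpha> * \<beta> = -1" "\<alpha> - \<beta> = sqrt 5" "\<alpha>\<^sup>2 = \<alpha> + 1" "\<beta>\<^sup>2 = \<beta> + 1" "\<alpha> > 3 / 2"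
    using s by (auto simp: \<alpha>_def \<beta>_def field_simps power2_eq_square)
  from 1(1) show "\<beta> \<noteq> 0" "\<alpha> \<noteq> 0" by auto
qed

lemma golden_power_Suc_Suc:
  "\<alpha> ^ Suc (Suc n) = \<alpha> ^ Suc n + \<alpha> ^ n" "\<beta> ^ Suc (Suc n) = \<beta> ^ Suc n + \<beta> ^ n"
proof -
  have "\<alpha> ^ Suc (Suc n) = \<alpha>\<^sup>2 * \<alpha> ^ n" "\<beta> ^ Suc (Suc n) = \<beta>\<^sup>2 * \<beta> ^ n"
    by (simp_all add: power2_eq_square)
  then show "\<alpha> ^ Suc (Suc n) = \<alpha> ^ Suc n + \<alpha> ^ n" "\<beta> ^ Suc (Suc n) = \<beta> ^ Suc n + \<beta> ^ n"
    unfolding golden_conj(3,4) by (simp_all add: algebra_simps)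
qed

lemma fibN_Binet: "fibN n = (\<alpha> ^ n - \<beta> ^ n) / sqrt 5"
proof (induction n rule: fibN.induct)
  case (3 n)
  then show ?case
    using 3 unfolding golden_power_Suc_Suc by (simp add: diff_divide_distrib add_divide_distrib del: power_Suc)
qed (simp_all add: golden_conj(2))

lemma lucN_Binet: "lucN n = \<alpha> ^ n + \<beta> ^ n"
proof (induction n rule: lucN.induct)
  case (3 n)
  then show ?case
    using 3 unfolding golden_power_Suc_Suc by (simp del: power_Suc)
qed (simp_all add: \<alpha>_def \<beta>_def field_simps)

lemma golden_inverse_power: "inverse (\<alpha> ^ n) = (-1) ^ n * \<beta> ^ n" "inverse (\<beta> ^ n) = (-1) ^ n * \<alpha> ^ n"
proof -
  have "inverse \<alpha> = - \<beta>" "inverse \<beta> = - \<alpha>"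
    using golden_conj(1,6,7) by (auto simp: field_simps)
  then show "inverse (\<alpha> ^ n) = (-1) ^ n * \<beta> ^ n" "inverse (\<beta> ^ n) = (-1) ^ n * \<alpha> ^ n"
    by (simp_all add: power_inverse[symmetric] power_minus[of \<beta>] power_minus[of \<alpha>])
qed

lemma F_Binet: "F n = (\<alpha> powi n - \<beta> powi n) / sqrt 5"
proof (cases "n \<ge> 0")
  case True
  then show ?thesis by (simp add: F_def fibN_Binet power_int_def)
next
  case False
  define m where "m = nat (- n) - 1"
  have m: "nat (- n) = Suc m" using False by (simp add: m_def)
  have "\<alpha> powi n - \<beta> powi n = inverse (\<alpha> ^ Suc m) - inverse (\<beta> ^ Suc m)"
    using False m by (simp add: power_int_def power_inverse)
  also have "\<dots> = (-1) ^ m * (\<alpha> ^ Suc m - \<beta> ^ Suc m)"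
    unfolding golden_inverse_power by (simp add: algebra_simps)
  finally show ?thesis using False m by (simp add: F_def fibN_Binet)
qed

lemma L_Binet: "L n = \<alpha> powi n + \<beta> powi n"
proof (cases "n \<ge> 0")
  case True
  then show ?thesis by (simp add: L_def lucN_Binet power_int_def)
next
  case False
  define m where "m = nat (- n)"
  have "\<alpha> powi n + \<beta> powi n = inverse (\<alpha> ^ m) + inverse (\<beta> ^ m)"
    using False by (simp add: power_int_def power_inverse m_def)
  also have "\<dots> = (-1) ^ m * (\<alpha> ^ m + \<beta> ^ m)"
    unfolding golden_inverse_power by (simp add: algebra_simps)
  finally show ?thesis using False m_def by (simp add: L_def lucN_Binet)
qed

lemma golden_mult_powi: "\<alpha> powi n * \<beta> powi n = (-1) powi n"
  by (simp add: power_int_mult_distrib[symmetric] golden_conj(1))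

text \<open>After Binet's formula one power with exponent \<open>p + q\<close> cancels and
  \<open>\<alpha>^q - \<beta>^q\<close> factors out.\<close>

lemma F_add_conj:
  "F (p + q) - \<alpha> powi q * F p = \<beta> powi p * F q"
  "F (p + q) - \<beta> powi q * F p = \<alpha> powi p * F q"
proof -
  have "\<alpha> powi (p + q) = \<alpha> powi p * \<alpha> powi q" "\<beta> powi (p + q) = \<beta> powi p * \<beta> powi q"
    using golden_conj(6,7) by (simp_all add: power_int_add)
  then show "F (p + q) - \<alpha> powi q * F p = \<beta> powi p * F q"
    "F (p + q) - \<beta> powi q * F p = \<alpha> powi p * F q"
    by (simp_all add: F_Binet field_simps)
qed

lemma F_minus: "F (- n) = - ((-1) powi n * F n)"
proof -
  have e: "(-1) powi n * (-1) powi n = (1 :: real)"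
    by (simp add: power_int_mult_distrib[symmetric])
  have "x * ((-1) powi n * y) = 1" if "x * y = (-1) powi n" for x y :: real
  proof -
    have "x * ((-1) powi n * y) = (x * y) * (-1) powi n" by (simp only: mult_ac)
    then show ?thesis unfolding that e .
  qed
  from this[OF golden_mult_powi] this[OF trans[OF mult.commute golden_mult_powi]]
  have "\<alpha> powi (- n) = (-1) powi n * \<beta> powi n" "\<beta> powi (- n) = (-1) powi n * \<alpha> powi n"
    unfolding power_int_minus by (simp_all add: inverse_unique)
  then show ?thesis by (simp add: F_Binet field_simps)
qed

text \<open>Powers of \<open>\<alpha>\<close> obey the Fibonacci recurrence, so only the first two
  cases are numerical.\<close>

lemma fibN_bounds: "\<alpha> ^ n \<le> fibN (n + 2)" "fibN (n + 1) \<le> \<alpha> ^ n"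
proof -
  have a: "\<alpha> \<le> 2" using golden_conj(1) by (simp add: \<alpha>_def real_le_lsqrt)
  show "\<alpha> ^ n \<le> fibN (n + 2)"
  proof (induction n rule: fibN.induct)
    case (3 n)
    then show ?case unfolding golden_power_Suc_Suc by (simp del: power_Suc)
  qed (use a in \<open>simp_all add: numeral_2_eq_2\<close>)
  show "fibN (n + 1) \<le> \<alpha> ^ n"
  proof (induction n rule: fibN.induct)
    case (3 n)
    then show ?case unfolding golden_power_Suc_Suc by (simp del: power_Suc)
  qed (use golden_conj(5) in \<open>simp_all\<close>)
qed

text \<open>
  With \<open>m = p + q\<close>, \<open>n = - p\<close> this \<open>x\<close> is \<open>y\<^sup>3\<close> for \<open>\<alpha>\<close>, with \<open>m\<close> and \<open>n\<close> exchanged it is \<open>y\<^sup>3\<close> for \<open>\<beta>\<close>.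
  For even \<open>n\<close> it is negative and the last inequality is that of \<open>(1 - \<bar>x\<bar>)\<^sup>2 > 0\<close>.
\<close>
lemma fib_ratio_bound:
  fixes m n :: int
  assumes "m \<ge> 2" "n \<ge> 2"
  defines "x \<equiv> F m / (\<alpha> powi (m + n) * F (- n))"
  shows "x \<noteq> 0" "\<bar>x\<bar> < 1" "4 * \<bar>x\<bar> < (1 - x)\<^sup>2"
proof -
  define i where "i = nat (m - 2)"
  define j where "j = nat (n - 2)"
  have m: "m = int (i + 2)" and n: "n = int (j + 2)"
    using assms(1,2) by (auto simp: i_def j_def)
  define r where "r = fibN (i + 2) / (\<alpha> ^ (i + j + 4) * fibN (j + 2))"
  have "F (int k) = fibN k" for k
    by (simp add: F_def)
  then have F_m: "F m = fibN (i + 2)" and F_n: "F n = fibN (j + 2)"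
    unfolding m n by blast+
  have apow: "\<alpha> powi (m + n) = \<alpha> ^ (i + j + 4)"
    proof -
    have "int (i + 2) + int (j + 2) = int (i + j + 4)" by simp
    then show ?thesis unfolding m n by (simp only: power_int_of_nat)
  qed
  have "(-1) powi n = ((-1) ^ j :: real)"
    unfolding n power_int_of_nat by simp
  then have Fn: "F (- n) = - ((-1) ^ j * fibN (j + 2))"
    by (simp add: F_minus F_n)
  have a: "\<alpha> > 0" "\<alpha> \<ge> 1" using golden_conj(5) by auto
  have pos: "fibN (k + 2) > 0" for k
    using fibN_bounds(1)[of k] a by (meson less_le_trans zero_less_power)
  have r0: "r > 0" unfolding r_def using pos a by simp
  \<comment> \<open>The two bounds give
    \<open>r \<le> \<alpha>^(i+1) / (\<alpha>^(i+j+4) * \<alpha>^j)\<close>, where \<open>i\<close>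
    cancels: the estimate depends on \<open>j\<close> alone.\<close>
  have "\<alpha> ^ (2 * j + 3) * r \<le> 1"
  proof -
    have "\<alpha> ^ (2 * j + 3) * fibN (i + 2) \<le> \<alpha> ^ (2 * j + 3) * \<alpha> ^ (i + 1)"
      using fibN_bounds(2)[of "i + 1"] a by (intro mult_left_mono) auto
    also have "\<dots> = \<alpha> ^ (i + j + 4) * \<alpha> ^ j"
      unfolding power_add[symmetric] by (rule arg_cong) simp
    also have "\<dots> \<le> \<alpha> ^ (i + j + 4) * fibN (j + 2)"
      using fibN_bounds(1)[of j] a by (intro mult_left_mono) auto
    finally show ?thesis
      unfolding r_def times_divide_eq_right
      by (subst divide_le_eq_1_pos) (intro mult_pos_pos zero_less_power a pos)
  qed
  then have r_le: "r \<le> 1 / \<alpha> ^ (2 * j + 3)"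
    using a by (simp add: field_simps)
  have a2: "\<alpha> ^ (n + 2) \<ge> 9 / 4 * \<alpha> ^ n" for n
  proof -
    have "\<alpha>\<^sup>2 \<ge> 9 / 4" using golden_conj(3,5) by simp
    then show ?thesis using mult_left_mono[of "9 / 4" "\<alpha>\<^sup>2" "\<alpha> ^ n"] a unfolding power_add by simp
  qed
  have x: "x = - ((-1) ^ j * r)"
  proof -
    have "f / (c * - ((-1) ^ j * g)) = - ((-1) ^ j * (f / (c * g)))" for f c g :: real
      by (cases "even j") simp_all
    then show ?thesis unfolding x_def apow F_m Fn r_def .
  qed
  have "1 < \<alpha> ^ (2 * j + 3)"
    using golden_conj(5) by (intro one_less_power) auto
  then have "1 / \<alpha> ^ (2 * j + 3) < 1" by simp
  then have r1: "r < 1" using r_le by linarith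
  show "x \<noteq> 0" "\<bar>x\<bar> < 1"
    using r0 r1 by (simp_all add: x abs_mult)
  show "4 * \<bar>x\<bar> < (1 - x)\<^sup>2"
  proof (cases "even j")
    case True
    have "(1 - r)\<^sup>2 > 0" using r1 by simp
    then have "4 * r < (1 + r)\<^sup>2" by (simp add: power2_eq_square algebra_simps)
    then show ?thesis using True r0 by (simp add: x)
  next
    case False
    \<comment> \<open>For odd \<open>j\<close> the number \<open>x = r\<close> is positive and has
      to lie below \<open>3 - 2 * sqrt 2\<close>, about \<open>0.17\<close>. Oddness gives
      \<open>j \<ge> 1\<close>, hence an exponent of at least \<open>5\<close>, which suffices for
      \<open>r < 1 / 7\<close>.\<close>
    then have "j \<ge> 1" by (cases j) auto
    have "7 < \<alpha> ^ 1 * (81 / 16 )" using golden_conj(5) by simp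
    also have "\<dots> \<le> \<alpha> ^ 5"
      using a2[of 1] a2[of 3] by (simp add: eval_nat_numeral)
    also have "\<dots> \<le> \<alpha> ^ (2 * j + 3)"
      using \<open>j \<ge> 1\<close> a by (intro power_increasing) auto
    finally have "1 / \<alpha> ^ (2 * j + 3) < 1 / 7"
      by (simp add: field_simps)
    then have "r < 1 / 7" using r_le by linarith
    then have "(6 / 7)\<^sup>2 < (1 - r)\<^sup>2" "4 * r < 4 / 7"
      by (auto intro!: power_strict_mono)
    then have "4 * r < (1 - r)\<^sup>2" by (simp add: power2_eq_square)
    then show ?thesis using False r0 by (simp add: x)
  qed
qed

section \<open>The two conjugate parts of the sum\<close>

text \<open>Every quotient here is homogeneous of degree \<open>0\<close> in \<open>a\<close> and
  \<open>b\<close>, so after \<open>b = a * y\<close> a power of \<open>a\<close> cancels.\<close>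

lemma cubic_series_value_quotient:
  assumes "a \<noteq> 0" "a ^ 3 + b ^ 3 \<noteq> 0"
  shows "cubic_series_value (b / a) =
     - 4 * a ^ 3 * b ^ 3 / (a ^ 3 + b ^ 3)\<^sup>2
     - 2 / sqrt 3 * ((b ^ 3 - a ^ 3) * a * b * (a ^ 4 + b ^ 4 - 2 * a * b * (a\<^sup>2 + b\<^sup>2)) / (a ^ 3 + b ^ 3) ^ 3)
         * arctan (sqrt 3 * b / (2 * a + b))
     + 1 / 3 * ((b ^ 3 - a ^ 3) * a * b * (a ^ 4 - b ^ 4 + 2 * a * b * (a\<^sup>2 - b\<^sup>2)) / (a ^ 3 + b ^ 3) ^ 3)
         * ln ((b ^ 3 - a ^ 3) / (b - a) ^ 3)"
proof -
  define y where "y = b / a"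
  have b: "b = a * y" using assms(1) by (simp add: y_def)
  have d: "b ^ 3 - a ^ 3 = - (a ^ 3 * (1 - y ^ 3))" "b - a = - (a * (1 - y))"
    unfolding b by algebra+
  have cancel: "a ^ n * N / (a ^ n * D) = N / D" for n N D
    using assms(1) by simp
  have 1: "- 4 * a ^ 3 * b ^ 3 / (a ^ 3 + b ^ 3)\<^sup>2 = - 4 * y ^ 3 / (1 + y ^ 3)\<^sup>2"
  proof -
    have "- 4 * a ^ 3 * b ^ 3 = a ^ 6 * (- 4 * y ^ 3)" "(a ^ 3 + b ^ 3)\<^sup>2 = a ^ 6 * (1 + y ^ 3)\<^sup>2"
      unfolding b by algebra+
    then show ?thesis by (simp only: cancel)
  qed
  have den: "(a ^ 3 + b ^ 3) ^ 3 = a ^ 9 * (1 + y ^ 3) ^ 3"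
    unfolding b by algebra
  have 2: "(b ^ 3 - a ^ 3) * a * b * (a ^ 4 + b ^ 4 - 2 * a * b * (a\<^sup>2 + b\<^sup>2)) / (a ^ 3 + b ^ 3) ^ 3
     = - (y * (1 - y ^ 3) * (1 - 2 * y - 2 * y ^ 3 + y ^ 4)) / (1 + y ^ 3) ^ 3"
  proof -
    have "(b ^ 3 - a ^ 3) * a * b * (a ^ 4 + b ^ 4 - 2 * a * b * (a\<^sup>2 + b\<^sup>2))
      = a ^ 9 * - (y * (1 - y ^ 3) * (1 - 2 * y - 2 * y ^ 3 + y ^ 4))"
      unfolding b by algebra
    then show ?thesis by (simp only: cancel den)
  qed
  have 3: "(b ^ 3 - a ^ 3) * a * b * (a ^ 4 - b ^ 4 + 2 * a * b * (a\<^sup>2 - b\<^sup>2)) / (a ^ 3 + b ^ 3) ^ 3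
     = - (y * (1 - y ^ 3) * (1 + 2 * y - 2 * y ^ 3 - y ^ 4)) / (1 + y ^ 3) ^ 3"
  proof -
    have "(b ^ 3 - a ^ 3) * a * b * (a ^ 4 - b ^ 4 + 2 * a * b * (a\<^sup>2 - b\<^sup>2))
      = a ^ 9 * - (y * (1 - y ^ 3) * (1 + 2 * y - 2 * y ^ 3 - y ^ 4))"
      unfolding b by algebra
    then show ?thesis by (simp only: cancel den)
  qed
  have 4: "sqrt 3 * b / (2 * a + b) = sqrt 3 * y / (2 + y)"
  proof -
    have "sqrt 3 * b / (2 * a + b) = (a * (sqrt 3 * y)) / (a * (2 + y))"
      unfolding b by (simp add: algebra_simps)
    then show ?thesis using assms(1) by simp
  qed
  have 5: "(b ^ 3 - a ^ 3) / (b - a) ^ 3 = (1 - y ^ 3) / (1 - y) ^ 3"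
    unfolding d using assms(1) by (simp add: power_mult_distrib)
  show ?thesis
    unfolding 1 2 3 4 5 y_def[symmetric] cubic_series_value_def by simp
qed

context
  fixes p q :: int and s :: real and u v N \<sigma> a b :: real
  assumes s: "s \<noteq> 0"
    and rel: "F (p + q) - s powi q * F p = (-1) powi p * s powi (- p) * F q"
    and nz: "F p \<noteq> 0" "F q \<noteq> 0" "F (p + q) \<noteq> 0"
  defines "u \<equiv> s powi q * F p" and "v \<equiv> F (p + q)"
    and "N \<equiv> F q * cbrt (F p * F (p + q))" and "\<sigma> \<equiv> (-1) powi p"
    and "a \<equiv> cbrt (s powi q * F p)" and "b \<equiv> cbrt (F (p + q))"
begin

lemma cbrt_cube_uv: "a ^ 3 = u" "b ^ 3 = v"
  by (simp_all add: a_def b_def u_def v_def odd_real_root_pow)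

text \<open>By \<open>rel\<close>, \<open>(v - u)^2\<close> is \<open>s^(-2p) * (F q)^2\<close>,
  while \<open>u * v\<close> contains \<open>s^q\<close>. So \<open>- 27 u v / (v - u)^2\<close>
  carries exactly the power \<open>s^(2p+q)\<close> that Binet's formula puts into the
  series.\<close>

lemma series_argument:
  "(-1) powi (int k - p) * (27 * F p * F (p + q) / F q ^ 2) ^ k * s powi ((2 * p + q) * int k)
    = \<sigma> * (- 27 * u * v / (v - u)\<^sup>2) ^ k"
proof -
  have e: "\<sigma> * \<sigma> = 1"
    by (simp add: \<sigma>_def power_int_mult_distrib[symmetric])
  then have "inverse \<sigma> = \<sigma>" by (rule inverse_unique)
  then have 1: "(-1) powi (int k - p) = \<sigma> * (-1) ^ k"
    by (simp add: power_int_diff \<sigma>_def divide_inverse)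
  have 2: "s powi ((2 * p + q) * int k) = (s powi (2 * p + q)) ^ k"
    by (simp add: power_int_mult)
  have "(v - u)\<^sup>2 = (s powi (- p))\<^sup>2 * (F q)\<^sup>2"
    using e rel by (simp add: v_def u_def \<sigma>_def power_mult_distrib power2_eq_square)
  moreover have "s powi (2 * p) = (s powi p)\<^sup>2"
    using power_int_mult[of s p 2] by (simp add: mult.commute)
  then have "s powi (2 * p + q) = s powi q / (s powi (- p))\<^sup>2"
    using s by (simp add: power_int_add power_int_minus field_simps)
  ultimately have z: "- 27 * u * v / (v - u)\<^sup>2 = - 1 * (27 * F p * F (p + q) / F q ^ 2) * s powi (2 * p + q)"
    using nz s by (simp add: u_def v_def field_simps)
  show ?thesis
    unfolding 1 2 z power_mult_distrib by (simp only: mult.assoc)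
qed

text \<open>The cube root of \<open>s^(q-3p)\<close> is \<open>s^(-p) * cbrt (s^q)\<close>. The
  first factor joins \<open>F q\<close> to give \<open>\<sigma> * (v - u)\<close>, the second joins
  \<open>cbrt (F p * F (p + q))\<close> to give \<open>a * b\<close>.\<close>

lemma B_prefactor: "cbrt (s powi (q - 3 * p)) * N = \<sigma> * ((v - u) * a * b)"
proof -
  have "s powi (q - 3 * p) = (s powi (- p)) ^ 3 * s powi q"
  proof -
    have "s powi (q - 3 * p) = s powi ((- p) * 3 + q)"
      by (rule arg_cong[where f = "\<lambda>n. s powi n"]) simp
    also have "\<dots> = s powi ((- p) * 3) * s powi q"
      using s by (intro power_int_add) simp
    also have "s powi ((- p) * 3) = (s powi (- p)) ^ 3"
      unfolding power_int_mult by simp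
    finally show ?thesis .
  qed
  then have "cbrt (s powi (q - 3 * p)) = s powi (- p) * cbrt (s powi q)"
    by (simp add: real_root_mult odd_real_root_power_cancel)
  moreover have "\<sigma> * \<sigma> = 1"
    by (simp add: \<sigma>_def power_int_mult_distrib[symmetric])
  ultimately show ?thesis
    using rel by (simp add: N_def u_def v_def a_def b_def \<sigma>_def real_root_mult)
qed

lemma N_nz: "N \<noteq> 0"
  using nz by (simp add: N_def)

lemma B_prefactor': "cbrt (s powi (q - 3 * p)) = \<sigma> / N * ((v - u) * a * b)"
  using B_prefactor N_nz by (simp add: eq_divide_eq)

lemma cbrt_powers:
  "cbrt (s powi (4 * q) * F p ^ 4) = a ^ 4" "cbrt (s powi (2 * q) * F p ^ 2) = a\<^sup>2"
  "cbrt (F (p + q) ^ 4) = b ^ 4" "cbrt (F (p + q) ^ 2) = b\<^sup>2"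
  "cbrt (s powi q * F p * F (p + q)) = a * b"
proof -
  have "s powi (4 * q) = (s powi q) ^ 4" "s powi (2 * q) = (s powi q)\<^sup>2"
    using power_int_mult[of s q 4] power_int_mult[of s q 2] by (simp_all add: mult.commute)
  then show "cbrt (s powi (4 * q) * F p ^ 4) = a ^ 4" "cbrt (s powi (2 * q) * F p ^ 2) = a\<^sup>2"
    by (simp_all only: a_def power_mult_distrib[symmetric] real_root_power zero_less_numeral)
  show "cbrt (F (p + q) ^ 4) = b ^ 4" "cbrt (F (p + q) ^ 2) = b\<^sup>2"
    by (simp_all add: b_def real_root_power)
  show "cbrt (s powi q * F p * F (p + q)) = a * b"
    by (simp only: a_def b_def real_root_mult)
qed

lemma Bplus_eq:
  "Bplus p q s = \<sigma> / N * ((v - u) * a * b * (a ^ 4 + b ^ 4 - 2 * a * b * (a\<^sup>2 + b\<^sup>2)) / (u + v) ^ 3)"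
  unfolding Bplus_def cbrt_powers B_prefactor' unfolding u_def[symmetric] v_def[symmetric]
  by simp

lemma Bminus_eq:
  "Bminus p q s = \<sigma> / N * ((v - u) * a * b * (a ^ 4 - b ^ 4 + 2 * a * b * (a\<^sup>2 - b\<^sup>2)) / (u + v) ^ 3)"
  unfolding Bminus_def cbrt_powers B_prefactor' unfolding u_def[symmetric] v_def[symmetric]
  by simp

text \<open>The argument \<open>- 27 x / (1 - x)^2\<close> does not change when \<open>x\<close> is
  replaced by \<open>1 / x\<close>, so whichever of the two ratios is less than \<open>1\<close> in
  absolute value may be used.\<close>

lemma series_term_sums:
  assumes x: "x = u / v \<or> x = v / u" "x \<noteq> 0" "\<bar>x\<bar> < 1" "4 * \<bar>x\<bar> < (1 - x)\<^sup>2"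
  shows "(\<lambda>k. (-1) powi (int (Suc k) - p) * (27 * F p * F (p + q) / F q ^ 2) ^ Suc k
      * s powi ((2 * p + q) * int (Suc k)) / real ((3 * Suc k) choose (Suc k)))
    sums (\<sigma> * cubic_series_value (cbrt x))"
proof -
  have uv: "u \<noteq> 0" "v \<noteq> 0" using nz s by (auto simp: u_def v_def)
  have x3: "cbrt x ^ 3 = x" by (simp add: odd_real_root_pow)
  have "-1 < x" "x < 1"
    using x(3) by auto
  then have "cbrt (-1) < cbrt x" "cbrt x < cbrt 1"
    by (simp_all only: real_root_less_iff zero_less_numeral)
  then have c: "cbrt x \<noteq> 0" "-1 < cbrt x" "cbrt x < 1"
    using x(2) by (simp_all add: real_root_minus)
  have "- 27 * u * v / (v - u)\<^sup>2 = - 27 * x / (1 - x)\<^sup>2"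
    using x(1)
  proof
    assume "x = u / v"
    then have u: "u = x * v" using uv by simp
    then have "v - u = v * (1 - x)" by (simp add: algebra_simps)
    then show ?thesis using uv by (simp add: u power_mult_distrib power2_eq_square)
  next
    assume "x = v / u"
    then have v: "v = x * u" using uv by simp
    then have "v - u = - (u * (1 - x))" by (simp add: algebra_simps)
    then show ?thesis using uv by (simp add: v power_mult_distrib power2_eq_square)
  qed
  moreover have "(\<lambda>k. (- 27 * x / (1 - x)\<^sup>2) ^ Suc k / real ((3 * Suc k) choose (Suc k)))
      sums cubic_series_value (cbrt x)"
    using cubic_series_sums[OF c] x(4) unfolding x3 by simp
  ultimately have "(\<lambda>k. (- 27 * u * v / (v - u)\<^sup>2) ^ Suc k / real ((3 * Suc k) choose (Suc k)))
      sums cubic_series_value (cbrt x)" by simp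
  from sums_mult[OF this, of \<sigma>] show ?thesis
    unfolding series_argument by (simp only: times_divide_eq_right)
qed

end

lemma alpha_part:
  assumes nz: "F p \<noteq> 0" "F q \<noteq> 0" "F (p + q) \<noteq> 0" and sum: "\<alpha> powi q * F p + F (p + q) \<noteq> 0"
  defines "c \<equiv> (-1) powi p / (F q * cbrt (F p * F (p + q)))"
  shows "c * cubic_series_value (cbrt (F (p + q) / (\<alpha> powi q * F p))) =
    c * (- 4 * (\<alpha> powi q * F p) * F (p + q) / (\<alpha> powi q * F p + F (p + q))\<^sup>2)
    - 2 / sqrt 3 * (Bplus p q \<alpha> * T1 p q) + 1 / 3 * (Bminus p q \<alpha> * G1 p q)"
proof -
  define a where "a = cbrt (\<alpha> powi q * F p)"
  define b where "b = cbrt (F (p + q))"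
  have a3: "a ^ 3 = \<alpha> powi q * F p" and b3: "b ^ 3 = F (p + q)"
    by (simp_all add: a_def b_def odd_real_root_pow)
  have "\<alpha> powi p * ((-1) powi p * \<alpha> powi (- p)) = \<alpha> powi p * \<beta> powi p"
    using golden_conj(7) by (simp add: power_int_minus golden_mult_powi)
  then have \<beta>p: "\<beta> powi p = (-1) powi p * \<alpha> powi (- p)"
    using golden_conj(7) by simp
  have rel: "F (p + q) - \<alpha> powi q * F p = (-1) powi p * \<alpha> powi (- p) * F q"
    unfolding F_add_conj(1) \<beta>p by simp
  have G: "G1 p q = ln ((b ^ 3 - a ^ 3) / (b - a) ^ 3)"
  proof -
    \<comment> \<open>Taking \<open>cbrt (\<alpha>^p)\<close> out of the difference leaves
      \<open>\<alpha>^(-p)\<close> to join the numerator of \<open>G1\<close>, which by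
      \<open>rel\<close> becomes \<open>b^3 - a^3\<close>.\<close>
    have "cbrt (\<alpha> powi p * F (p+q)) - cbrt (\<alpha> powi (p+q) * F p) = cbrt (\<alpha> powi p) * (b - a)"
      using golden_conj(7) by (simp add: a_def b_def real_root_mult power_int_add algebra_simps)
    then have "(cbrt (\<alpha> powi p * F (p+q)) - cbrt (\<alpha> powi (p+q) * F p)) ^ 3 = \<alpha> powi p * (b - a) ^ 3"
      by (simp add: power_mult_distrib odd_real_root_pow)
    then show ?thesis
      unfolding G1_def a3 b3 rel by (simp add: power_int_minus divide_simps)
  qed
  have T: "T1 p q = arctan (sqrt 3 * b / (2 * a + b))"
    by (simp add: T1_def a_def b_def)
  have quot: "cbrt (F (p + q) / (\<alpha> powi q * F p)) = b / a"
    by (simp add: a_def b_def real_root_divide)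
  have a0: "a \<noteq> 0"
    using nz golden_conj(7) by (simp add: a_def)
  note B = Bplus_eq[OF golden_conj(7) rel nz] Bminus_eq[OF golden_conj(7) rel nz]
  have distrib: "c * (R - 2 / sqrt 3 * P * t + 1 / 3 * Q * l) = c * R - 2 / sqrt 3 * (c * P * t) + 1 / 3 * (c * Q * l)"
    for R P t Q l
    by (simp add: algebra_simps)
  have sum': "a ^ 3 + b ^ 3 \<noteq> 0"
    using sum unfolding a3 b3 .
  show ?thesis
    unfolding quot B T G cubic_series_value_quotient[OF a0 sum']
    unfolding a_def[symmetric] b_def[symmetric] unfolding c_def[symmetric] unfolding a3[symmetric] b3[symmetric]
    by (rule distrib)
qed

text \<open>Now the small ratio is \<open>u / v\<close>, so \<open>a\<close> and \<open>b\<close>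
  exchange roles. The coefficient of the arctangent is antisymmetric under this exchange and that of
  the logarithm symmetric, so only the arctangent term changes sign against
  \<open>alpha_part\<close>.\<close>

lemma beta_part:
  assumes nz: "F p \<noteq> 0" "F q \<noteq> 0" "F (p + q) \<noteq> 0" and sum: "\<beta> powi q * F p + F (p + q) \<noteq> 0"
  defines "c \<equiv> (-1) powi p / (F q * cbrt (F p * F (p + q)))"
  shows "c * cubic_series_value (cbrt (\<beta> powi q * F p / F (p + q))) =
    c * (- 4 * (\<beta> powi q * F p) * F (p + q) / (\<beta> powi q * F p + F (p + q))\<^sup>2)
    + 2 / sqrt 3 * (Bplus p q \<beta> * T2 p q) + 1 / 3 * (Bminus p q \<beta> * G2 p q)"
proof -
  define a where "a = cbrt (\<beta> powi q * F p)"
  define b where "b = cbrt (F (p + q))"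
  have a3: "a ^ 3 = \<beta> powi q * F p" and b3: "b ^ 3 = F (p + q)"
    by (simp_all add: a_def b_def odd_real_root_pow)
  have "\<beta> powi p * ((-1) powi p * \<beta> powi (- p)) = \<beta> powi p * \<alpha> powi p"
    using golden_conj(6) golden_mult_powi[of p] by (simp add: power_int_minus mult.commute)
  then have \<alpha>p: "\<alpha> powi p = (-1) powi p * \<beta> powi (- p)"
    using golden_conj(6) by simp
  have rel: "F (p + q) - \<beta> powi q * F p = (-1) powi p * \<beta> powi (- p) * F q"
    unfolding F_add_conj(2) \<alpha>p by simp
  have e: "cbrt ((-1) powi q) = (-1) powi q"
    by (cases "even q") (simp_all add: power_int_minus_one_minus real_root_minus)
  \<comment> \<open>\<open>T2\<close> and \<open>G2\<close> are written with
    \<open>\<alpha>^q\<close> but \<open>a\<close> contains \<open>\<beta>^q\<close>; this product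
    converts between them.\<close>
  have \<alpha>\<beta>: "cbrt (\<alpha> powi q) * cbrt (\<beta> powi q) = (-1) powi q"
    using e by (simp add: golden_mult_powi flip: real_root_mult)
  have e2: "(-1) powi q * (-1) powi q = (1 :: real)"
    by (simp add: power_int_mult_distrib[symmetric])
  have G: "G2 p q = ln ((b ^ 3 - a ^ 3) / (b - a) ^ 3)"
  proof -
    have "cbrt (\<alpha> powi q * F (p+q)) - (-1) powi q * cbrt (F p) = cbrt (\<alpha> powi q) * (b - a)"
      unfolding \<alpha>\<beta>[symmetric] by (simp add: a_def b_def real_root_mult algebra_simps)
    then have "(cbrt (\<alpha> powi q * F (p+q)) - (-1) powi q * cbrt (F p)) ^ 3 = \<alpha> powi q * (b - a) ^ 3"
      by (simp add: power_mult_distrib odd_real_root_pow)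
    then show ?thesis
      unfolding G2_def a3 b3 F_add_conj(2) using golden_conj(7) by (simp add: power_int_add)
  qed
  have T: "T2 p q = arctan (sqrt 3 * a / (2 * b + a))"
  proof -
    have \<beta>0: "cbrt (\<beta> powi q) \<noteq> 0" using golden_conj(6) by simp
    have "sqrt 3 * cbrt (F p) / (2 * (-1) powi q * cbrt (\<alpha> powi q * F (p+q)) + cbrt (F p))
      = cbrt (\<beta> powi q) * (sqrt 3 * cbrt (F p))
        / (cbrt (\<beta> powi q) * (2 * (-1) powi q * cbrt (\<alpha> powi q * F (p+q)) + cbrt (F p)))"
      using \<beta>0 by simp
    also have "cbrt (\<beta> powi q) * (2 * (-1) powi q * cbrt (\<alpha> powi q * F (p+q)) + cbrt (F p))
      = 2 * ((-1) powi q * (cbrt (\<alpha> powi q) * cbrt (\<beta> powi q))) * b + a"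
      by (simp add: a_def b_def real_root_mult algebra_simps)
    also have "\<dots> = 2 * b + a" unfolding \<alpha>\<beta> e2 by simp
    finally show ?thesis by (simp add: T2_def a_def real_root_mult mult_ac)
  qed
  have quot: "cbrt (\<beta> powi q * F p / F (p + q)) = a / b"
    by (simp add: a_def b_def real_root_divide)
  have b0: "b \<noteq> 0"
    using nz by (simp add: b_def)
  have swap: "(a ^ 3 - b ^ 3) / (a - b) ^ 3 = (b ^ 3 - a ^ 3) / (b - a) ^ 3"
  proof -
    have "a ^ 3 - b ^ 3 = - (b ^ 3 - a ^ 3)" "(a - b) ^ 3 = - ((b - a) ^ 3)"
      by algebra+
    then show ?thesis by (simp only: minus_divide_divide)
  qed
  have neg: "(a ^ 3 - b ^ 3) * b * a * (b ^ 4 + a ^ 4 - 2 * b * a * (b\<^sup>2 + a\<^sup>2))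
      = - ((b ^ 3 - a ^ 3) * a * b * (a ^ 4 + b ^ 4 - 2 * a * b * (a\<^sup>2 + b\<^sup>2)))"
    "(a ^ 3 - b ^ 3) * b * a * (b ^ 4 - a ^ 4 + 2 * b * a * (b\<^sup>2 - a\<^sup>2))
      = (b ^ 3 - a ^ 3) * a * b * (a ^ 4 - b ^ 4 + 2 * a * b * (a\<^sup>2 - b\<^sup>2))"
    by algebra+
  note B = Bplus_eq[OF golden_conj(6) rel nz] Bminus_eq[OF golden_conj(6) rel nz]
  have distrib: "c * (R - 2 / sqrt 3 * (- P / D) * t + 1 / 3 * Q * l) = c * R + 2 / sqrt 3 * (c * (P / D) * t) + 1 / 3 * (c * Q * l)"
    for R P D t Q l
    by (simp add: algebra_simps)
  have sum': "b ^ 3 + a ^ 3 \<noteq> 0"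
    using sum unfolding a3 b3 by (simp add: add.commute)
  have comm: "b ^ 3 + a ^ 3 = a ^ 3 + b ^ 3" "- 4 * b ^ 3 * a ^ 3 = - 4 * a ^ 3 * b ^ 3"
    by simp_all
  show ?thesis
    unfolding quot B T G cubic_series_value_quotient[OF b0 sum'] swap neg comm
    unfolding a_def[symmetric] b_def[symmetric] unfolding c_def[symmetric] unfolding a3[symmetric] b3[symmetric]
    by (rule distrib)
qed

section \<open>Combining the two conjugate parts\<close>

text \<open>With \<open>A\<close>, \<open>B\<close> for \<open>u \<alpha>\<close>,
  \<open>u \<beta>\<close>, the numerator of the difference factors as
  \<open>(A - B) * (v^2 - A * B)\<close> up to \<open>- 4 * v\<close>, and
  \<open>f * v = h^3\<close> cancels the \<open>h\<close> of the prefactor.\<close>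

lemma rational_part_F:
  fixes A B v f g h e r c :: real
  assumes "A - B = r * g * f" "A * B = e * f\<^sup>2" "h ^ 3 = f * v"
    and nz: "h \<noteq> 0" "g \<noteq> 0" "r \<noteq> 0" "A + v \<noteq> 0" "B + v \<noteq> 0"
  shows "1 / r * (c / (g * h) * (- 4 * A * v / (A + v)\<^sup>2) - c / (g * h) * (- 4 * B * v / (B + v)\<^sup>2))
     = 4 * (- c) * h\<^sup>2 * (v\<^sup>2 - e * f\<^sup>2) / ((v + A)\<^sup>2 * (v + B)\<^sup>2)"
proof -
  have "- 4 * A * v / (A + v)\<^sup>2 - (- 4 * B * v / (B + v)\<^sup>2)
      = (- 4 * A * v * (B + v)\<^sup>2 + 4 * B * v * (A + v)\<^sup>2) / ((A + v)\<^sup>2 * (B + v)\<^sup>2)"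
    using nz by (simp add: field_simps)
  also have "- 4 * A * v * (B + v)\<^sup>2 + 4 * B * v * (A + v)\<^sup>2 = - 4 * v * (A - B) * (v\<^sup>2 - A * B)"
    by algebra
  also have "\<dots> = r * g * h * (4 * (- 1) * h\<^sup>2 * (v\<^sup>2 - e * f\<^sup>2))"
    unfolding assms(1,2) using assms(3) by algebra
  finally have "- 4 * A * v / (A + v)\<^sup>2 - (- 4 * B * v / (B + v)\<^sup>2)
      = r * g * h * (4 * (- 1) * h\<^sup>2 * (v\<^sup>2 - e * f\<^sup>2) / ((A + v)\<^sup>2 * (B + v)\<^sup>2))"
    by simp
  then show ?thesis
    unfolding right_diff_distrib[symmetric] using nz by (simp add: add.commute)
qed

text \<open>The numerator of the sum is symmetric in \<open>A\<close> and \<open>B\<close>, so only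
  \<open>A + B\<close> and \<open>A * B\<close> enter; \<open>e * e = 1\<close> allows
  \<open>e\<close> to be taken out.\<close>

lemma rational_part_L:
  fixes A B v f g h e l c :: real
  assumes "A + B = l * f" "A * B = e * f\<^sup>2" "h ^ 3 = f * v" "e * e = 1"
    and nz: "h \<noteq> 0" "g \<noteq> 0" "A + v \<noteq> 0" "B + v \<noteq> 0"
  shows "c / (g * h) * (- 4 * A * v / (A + v)\<^sup>2) + c / (g * h) * (- 4 * B * v / (B + v)\<^sup>2)
     = 4 * (- (c * e)) * h\<^sup>2 / g * (f\<^sup>2 * l + e * v\<^sup>2 * l + 4 * f * v) / ((v + A)\<^sup>2 * (v + B)\<^sup>2)"
proof -
  have "- 4 * A * v / (A + v)\<^sup>2 + - 4 * B * v / (B + v)\<^sup>2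
      = (- 4 * A * v * (B + v)\<^sup>2 + - 4 * B * v * (A + v)\<^sup>2) / ((A + v)\<^sup>2 * (B + v)\<^sup>2)"
    using nz by (simp add: field_simps)
  also have "- 4 * A * v * (B + v)\<^sup>2 + - 4 * B * v * (A + v)\<^sup>2 = - 4 * v * ((A + B) * (v\<^sup>2 + A * B) + 4 * (A * B) * v)"
    by algebra
  also have "\<dots> = h * (4 * (- e) * h\<^sup>2 * (f\<^sup>2 * l + e * v\<^sup>2 * l + 4 * f * v))"
    unfolding assms(1,2) using assms(3,4) by algebra
  finally have "- 4 * A * v / (A + v)\<^sup>2 + - 4 * B * v / (B + v)\<^sup>2
      = h * (4 * (- e) * h\<^sup>2 * (f\<^sup>2 * l + e * v\<^sup>2 * l + 4 * f * v) / ((A + v)\<^sup>2 * (B + v)\<^sup>2))"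
    by simp
  then show ?thesis
    unfolding distrib_left[symmetric] using nz by (simp add: add.commute)
qed

theorem theorem10:
  fixes p q :: int
  assumes "p \<le> -2" and "q \<ge> 4" and "\<bar>q\<bar> > \<bar>p\<bar> + 1"
  shows "(\<lambda>k. 1 / (F q * cbrt (F p * F (p+q))) *
            ((-1) powi (int (Suc k) - p) * (27 * F p * F (p+q) / F q ^ 2) ^ (Suc k)
             * F ((2*p + q) * int (Suc k)) / real ((3 * Suc k) choose (Suc k))))
         sums
           (4 * (-1) powi (p - 1) * cbrt (F (p+q) ^ 2 * F p ^ 2) * (F (p+q) ^ 2 - (-1) powi q * F p ^ 2)
              / ((F (p+q) + \<alpha> powi q * F p) ^ 2 * (F (p+q) + \<beta> powi q * F p) ^ 2)
            - 2 * sqrt 15 / 15 * (Bplus p q \<alpha> * T1 p q + Bplus p q \<beta> * T2 p q)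
            + sqrt 5 / 15 * (Bminus p q \<alpha> * G1 p q - Bminus p q \<beta> * G2 p q))
       \<and>
         (\<lambda>k. 1 / (F q * cbrt (F p * F (p+q))) *
            ((-1) powi (int (Suc k) - p) * (27 * F p * F (p+q) / F q ^ 2) ^ (Suc k)
             * L ((2*p + q) * int (Suc k)) / real ((3 * Suc k) choose (Suc k))))
         sums
           (4 * (-1) powi (p - q - 1) * cbrt (F (p+q) ^ 2 * F p ^ 2) / F q
              * (F p ^ 2 * L q + (-1) powi q * F (p+q) ^ 2 * L q + 4 * F p * F (p+q))
              / ((F (p+q) + \<alpha> powi q * F p) ^ 2 * (F (p+q) + \<beta> powi q * F p) ^ 2)
            - 2 / sqrt 3 * (Bplus p q \<alpha> * T1 p q - Bplus p q \<beta> * T2 p q)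
            + 1 / 3 * (Bminus p q \<alpha> * G1 p q + Bminus p q \<beta> * G2 p q))"
proof -
  define u where "u s = s powi q * F p" for s
  define v where "v = F (p + q)"
  define h where "h = cbrt (F p * F (p + q))"
  define N where "N = F q * h"
  define \<sigma> :: real where "\<sigma> = (-1) powi p"
  define e :: real where "e = (-1) powi q"
  define x where "x = v / u \<alpha>"
  define y where "y = u \<beta> / v"
  have e2: "e * e = 1"
    by (simp add: e_def power_int_mult_distrib[symmetric])
  then have inverse_e: "inverse e = e"
    by (rule inverse_unique)
  \<comment> \<open>For these signs the last assumption reads \<open>q > - p + 1\<close>, which
    between integers is \<open>p + q \<ge> 2\<close>.\<close>
  have m: "p + q \<ge> 2" and n: "- p \<ge> 2"
    using assms by auto
  have x: "x \<noteq> 0" "\<bar>x\<bar> < 1" "4 * \<bar>x\<bar> < (1 - x)\<^sup>2"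
    using fib_ratio_bound[OF m n] by (simp_all add: x_def u_def v_def)
  have nz: "F p \<noteq> 0" "F q \<noteq> 0" "F (p + q) \<noteq> 0"
  proof -
    show "F p \<noteq> 0" "F (p + q) \<noteq> 0"
      using x(1) by (auto simp: x_def u_def v_def)
    show "F q \<noteq> 0"
      using fib_ratio_bound(1)[of q 2] assms by auto
  qed
  \<comment> \<open>Reflecting both indices and using \<open>\<beta>^q = (-1)^q / \<alpha>^q\<close>
    brings \<open>y\<close> into the form of \<open>fib_ratio_bound\<close> with its two indices
    exchanged.\<close>
  have "y = F (- p) / (\<alpha> powi (- p + (p + q)) * F (- (p + q)))"
  proof -
    have "\<beta> powi q = e / \<alpha> powi q"
      using golden_mult_powi[of q] golden_conj(7) by (simp add: e_def field_simps)
    moreover have "F (- (p + q)) = - (\<sigma> * e * F (p + q))" "F (- p) = - (\<sigma> * F p)"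
      by (simp_all only: F_minus) (simp_all add: \<sigma>_def e_def power_int_add)
    moreover have "\<sigma> \<noteq> 0"
      by (simp add: \<sigma>_def)
    moreover have "b / (c * (e * d)) = e * b / (c * d)" for b c d
      using inverse_e by (simp add: divide_inverse)
    ultimately show ?thesis
      by (simp add: y_def u_def v_def)
  qed
  then have y: "y \<noteq> 0" "\<bar>y\<bar> < 1" "4 * \<bar>y\<bar> < (1 - y)\<^sup>2"
    using fib_ratio_bound[OF n m] by simp_all
  have sum: "u \<alpha> + v \<noteq> 0" "u \<beta> + v \<noteq> 0"
  proof -
    have "x \<noteq> -1" "y \<noteq> -1"
      using x(2) y(2) by auto
    moreover have "u \<alpha> \<noteq> 0" "v \<noteq> 0"
      using x(1) by (auto simp: x_def)
    ultimately show "u \<alpha> + v \<noteq> 0" "u \<beta> + v \<noteq> 0"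
      by (auto simp: x_def y_def field_simps add_eq_0_iff)
  qed
  have hN: "h \<noteq> 0" "N \<noteq> 0" "h ^ 3 = F p * v"
    using nz by (simp_all add: h_def N_def v_def odd_real_root_pow)
  have rel: "F (p + q) - \<alpha> powi q * F p = (-1) powi p * \<alpha> powi (- p) * F q"
    "F (p + q) - \<beta> powi q * F p = (-1) powi p * \<beta> powi (- p) * F q"
    unfolding F_add_conj golden_mult_powi[symmetric] using golden_conj(6,7)
    by (simp_all add: power_int_minus)
  define t where "t s k = (-1) powi (int (Suc k) - p) * (27 * F p * F (p + q) / F q ^ 2) ^ Suc k
      * s powi ((2 * p + q) * int (Suc k)) / real ((3 * Suc k) choose (Suc k))" for s k
  define Rx where "Rx = \<sigma> / N * (- 4 * u \<alpha> * v / (u \<alpha> + v)\<^sup>2)"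
  define Ry where "Ry = \<sigma> / N * (- 4 * u \<beta> * v / (u \<beta> + v)\<^sup>2)"
  have tx: "(\<lambda>k. 1 / N * t \<alpha> k) sums
      (Rx - 2 / sqrt 3 * (Bplus p q \<alpha> * T1 p q) + 1 / 3 * (Bminus p q \<alpha> * G1 p q))"
  proof -
    have "t \<alpha> sums (\<sigma> * cubic_series_value (cbrt x))"
      unfolding t_def \<sigma>_def using golden_conj(7) rel(1) nz x
      by (intro series_term_sums) (auto simp: x_def u_def v_def)
    from sums_mult[OF this, of "1 / N"] have "(\<lambda>k. 1 / N * t \<alpha> k) sums (\<sigma> / N * cubic_series_value (cbrt x))"
      by simp
    then show ?thesis
      using alpha_part[OF nz] sum(1)
      by (simp only: Rx_def x_def u_def v_def \<sigma>_def N_def h_def not_False_eq_True)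
  qed
  have ty: "(\<lambda>k. 1 / N * t \<beta> k) sums
      (Ry + 2 / sqrt 3 * (Bplus p q \<beta> * T2 p q) + 1 / 3 * (Bminus p q \<beta> * G2 p q))"
  proof -
    have "t \<beta> sums (\<sigma> * cubic_series_value (cbrt y))"
      unfolding t_def \<sigma>_def using golden_conj(6) rel(2) nz y
      by (intro series_term_sums) (auto simp: y_def u_def v_def)
    from sums_mult[OF this, of "1 / N"] have "(\<lambda>k. 1 / N * t \<beta> k) sums (\<sigma> / N * cubic_series_value (cbrt y))"
      by simp
    then show ?thesis
      using beta_part[OF nz] sum(2)
      by (simp only: Ry_def y_def u_def v_def \<sigma>_def N_def h_def not_False_eq_True)
  qed
  have uu: "u \<alpha> - u \<beta> = sqrt 5 * F q * F p" "u \<alpha> + u \<beta> = L q * F p" "u \<alpha> * u \<beta> = e * (F p)\<^sup>2"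
  proof -
    have "sqrt 5 * F q = \<alpha> powi q - \<beta> powi q"
      by (simp add: F_Binet)
    then show "u \<alpha> - u \<beta> = sqrt 5 * F q * F p"
      by (simp add: u_def left_diff_distrib)
    show "u \<alpha> + u \<beta> = L q * F p"
      unfolding u_def L_Binet by (simp add: algebra_simps)
    have "u \<alpha> * u \<beta> = (\<alpha> powi q * \<beta> powi q) * (F p)\<^sup>2"
      unfolding u_def by (simp add: power2_eq_square)
    then show "u \<alpha> * u \<beta> = e * (F p)\<^sup>2"
      unfolding golden_mult_powi e_def .
  qed
  have h2: "cbrt (F (p+q) ^ 2 * F p ^ 2) = h\<^sup>2"
    by (simp add: h_def real_root_power[symmetric] power_mult_distrib mult.commute)
  have sg1: "(-1) powi (p - 1) = - \<sigma>"
    by (simp add: \<sigma>_def power_int_diff)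
  have sg2: "(-1) powi (p - q - 1) = - (\<sigma> * e)"
    using inverse_e by (simp add: \<sigma>_def e_def power_int_diff divide_inverse)
  have RF: "1 / sqrt 5 * (Rx - Ry) = 4 * (-1) powi (p - 1) * cbrt (F (p+q) ^ 2 * F p ^ 2)
      * (F (p+q) ^ 2 - (-1) powi q * F p ^ 2)
      / ((F (p+q) + \<alpha> powi q * F p) ^ 2 * (F (p+q) + \<beta> powi q * F p) ^ 2)"
    unfolding h2 sg1 Rx_def Ry_def N_def unfolding e_def[symmetric] u_def[symmetric] v_def[symmetric]
    by (rule rational_part_F) (use uu hN nz sum in auto)
  have RL: "Rx + Ry = 4 * (-1) powi (p - q - 1) * cbrt (F (p+q) ^ 2 * F p ^ 2) / F q
      * (F p ^ 2 * L q + (-1) powi q * F (p+q) ^ 2 * L q + 4 * F p * F (p+q))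
      / ((F (p+q) + \<alpha> powi q * F p) ^ 2 * (F (p+q) + \<beta> powi q * F p) ^ 2)"
    unfolding h2 sg2 Rx_def Ry_def N_def unfolding e_def[symmetric] u_def[symmetric] v_def[symmetric]
    by (rule rational_part_L) (use uu hN nz sum e2 in auto)
  have "sqrt 15 = sqrt 3 * sqrt 5"
    by (simp flip: real_sqrt_mult)
  then have s15: "2 * sqrt 15 / 15 = 1 / sqrt 5 * (2 / sqrt 3)" "sqrt 5 / 15 = 1 / sqrt 5 * (1 / 3)"
    by (simp_all add: field_simps)
  \<comment> \<open>The arctangents enter the two parts with opposite signs. The difference in
    Binet's formula for \<open>F\<close> therefore adds them and subtracts the logarithms; the sum
    for \<open>L\<close> does the reverse.\<close>
  have "r * (X - m * a + n * c - (Y + m * b + n * d)) = r * (X - Y) - r * m * (a + b) + r * n * (c - d)"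
    for r m n X Y a b c d :: real
    by (simp add: algebra_simps)
  note value_F = this[of "1 / sqrt 5" Rx "2 / sqrt 3" _ "1 / 3" _ Ry]
  have "X - m * a + n * c + (Y + m * b + n * d) = X + Y - m * (a - b) + n * (c + d)"
    for m n X Y a b c d :: real
    by (simp add: algebra_simps)
  note value_L = this[of Rx "2 / sqrt 3" _ "1 / 3" _ Ry]
  have split_F: "1 / M * (c * K * ((x - y) / r) / C) = 1 / r * (1 / M * (c * K * x / C) - 1 / M * (c * K * y / C))"
    and split_L: "1 / M * (c * K * (x + y) / C) = 1 / M * (c * K * x / C) + 1 / M * (c * K * y / C)"
    for M c K x y r C :: real
    by (simp_all add: right_diff_distrib distrib_left diff_divide_distrib add_divide_distrib mult_ac)
  show ?thesis
  proof
    have term_F: "1 / N * ((-1) powi (int (Suc k) - p) * (27 * F p * F (p+q) / F q ^ 2) ^ (Suc k)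
             * F ((2*p + q) * int (Suc k)) / real ((3 * Suc k) choose (Suc k)))
        = 1 / sqrt 5 * (1 / N * t \<alpha> k - 1 / N * t \<beta> k)" for k
      unfolding t_def F_Binet[of "(2*p + q) * int (Suc k)"] by (rule split_F)
    show "(\<lambda>k. 1 / (F q * cbrt (F p * F (p+q))) *
            ((-1) powi (int (Suc k) - p) * (27 * F p * F (p+q) / F q ^ 2) ^ (Suc k)
             * F ((2*p + q) * int (Suc k)) / real ((3 * Suc k) choose (Suc k))))
         sums
           (4 * (-1) powi (p - 1) * cbrt (F (p+q) ^ 2 * F p ^ 2) * (F (p+q) ^ 2 - (-1) powi q * F p ^ 2)
              / ((F (p+q) + \<alpha> powi q * F p) ^ 2 * (F (p+q) + \<beta> powi q * F p) ^ 2)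
            - 2 * sqrt 15 / 15 * (Bplus p q \<alpha> * T1 p q + Bplus p q \<beta> * T2 p q)
            + sqrt 5 / 15 * (Bminus p q \<alpha> * G1 p q - Bminus p q \<beta> * G2 p q))"
      unfolding RF[symmetric] s15 h_def[symmetric] N_def[symmetric] term_F value_F[symmetric]
      by (intro sums_mult sums_diff tx ty)
  next
    have term_L: "1 / N * ((-1) powi (int (Suc k) - p) * (27 * F p * F (p+q) / F q ^ 2) ^ (Suc k)
             * L ((2*p + q) * int (Suc k)) / real ((3 * Suc k) choose (Suc k)))
        = 1 / N * t \<alpha> k + 1 / N * t \<beta> k" for k
      unfolding t_def L_Binet[of "(2*p + q) * int (Suc k)"] by (rule split_L)
    show "(\<lambda>k. 1 / (F q * cbrt (F p * F (p+q))) *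
            ((-1) powi (int (Suc k) - p) * (27 * F p * F (p+q) / F q ^ 2) ^ (Suc k)
             * L ((2*p + q) * int (Suc k)) / real ((3 * Suc k) choose (Suc k))))
         sums
           (4 * (-1) powi (p - q - 1) * cbrt (F (p+q) ^ 2 * F p ^ 2) / F q
              * (F p ^ 2 * L q + (-1) powi q * F (p+q) ^ 2 * L q + 4 * F p * F (p+q))
              / ((F (p+q) + \<alpha> powi q * F p) ^ 2 * (F (p+q) + \<beta> powi q * F p) ^ 2)
            - 2 / sqrt 3 * (Bplus p q \<alpha> * T1 p q - Bplus p q \<beta> * T2 p q)
            + 1 / 3 * (Bminus p q \<alpha> * G1 p q + Bminus p q \<beta> * G2 p q))"
      unfolding RL[symmetric] h_def[symmetric] N_def[symmetric] term_L value_L[symmetric]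
      by (intro sums_add tx ty)
  qed
qed

end
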